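(* Let $C_1^4,\dots,C_{16}^4$ be the code loops of rank $4$ with the following characteristic vectors: $\lambda(C_1^4)=(1110110100)$, $\lambda(C_2^4)=(0000000000)$, $\lambda(C_3^4)=(0000110100)$, $\lambda(C_4^4)=(0010100000)$, $\lambda(C_5^4)=(0000010100)$, $\lambda(C_6^4)=(1111110100)$, $\lambda(C_7^4)=(0001000000)$, $\lambda(C_8^4)=(0000001000)$, $\lambda(C_9^4)=(0100001000)$, $\lambda(C_{10}^4)=(0001111000)$, $\lambda(C_{11}^4)=(0001001000)$, $\lambda(C_{12}^4)=(0000001100)$, $\lambda(C_{13}^4)=(0110111100)$, $\lambda(C_{14}^4)=(0001001100)$, $\lambda(C_{15}^4)=(1001001100)$, $\lambda(C_{16}^4)=(0001111100)$. Then every nonassociative code loop of rank $4$ is isomorphic to one from this list, and no two distinct loops of the list are isomorphic to each other. Moreover, if $O_i^4$ denotes the orbit of the characteristic vector of $C_i^4$, then $|O_1^4|=1$, $|O_2^4|=7$, $|O_4^4|=21$, $|O_5^4|=|O_{14}^4|=|O_{15}^4|=28$, $|O_6^4|=8$, $|O_7^4|=|O_8^4|=|O_{13}^4|=56$, $|O_9^4|=|O_{12}^4|=|O_{16}^4|=168$, $|O_{10}^4|=|O_{11}^4|=112$.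
   Context: For $u,v,w\in\mathbf F_2^m$ let $|v|$ be the number of coordinates equal to $1$, and $|u\cap v|$, $|u\cap v\cap w|$ the number of coordinates where all listed vectors equal $1$. A double even code is a subspace $V\subseteq\mathbf F_2^m$ with $|v|\equiv0\pmod 4$ and $|u\cap v|\equiv 0\pmod 2$ for all $u,v\in V$. There is a function $\phi:V\times V\to\{1,-1\}$ with $\phi(v,v)=(-1)^{|v|/4}$, $\phi(v,w)=(-1)^{|v\cap w|/2}\phi(w,v)$, $\phi(0,v)=\phi(v,0)=1$, $\phi(v+w,u)=\phi(v,w+u)\phi(v,w)\phi(w,u)(-1)^{|v\cap w\cap u|}$. The code loop $L(V)$ is the set $\{1,-1\}\times V$ with product $(\epsilon,v)(\delta,w)=(\epsilon\delta\,\phi(v,w),v+w)$; it is a Moufang loop, of rank $\dim_{\mathbf F_2}V$. A code loop is a loop isomorphic to some $L(V)$. All squares, commutators $[x,y]=x^{-1}y^{-1}xy$ and associators $(x,y,z)=((xy)z)(x(yz))^{-1}$ lie in the central subloop $\{1,-1\}$. A nonassociative code loop $L$ of rank $4$ has generators $X=(a,b,c,d)$ (elements whose images form a basis of $L/\{\pm1\}$) with $(a,b,c)=-1$ and $(d,L,L)=1$. The characteristic vector of $L$ with respect to such $X$ is $\lambda_X(L)=(\lambda_1\dots\lambda_{10})\in\mathbf F_2^{10}$ given by $a^2=(-1)^{\lambda_1}$, $b^2=(-1)^{\lambda_2}$, $c^2=(-1)^{\lambda_3}$, $d^2=(-1)^{\lambda_4}$, $[a,b]=(-1)^{\lambda_5}$,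 $[a,c]=(-1)^{\lambda_6}$, $[a,d]=(-1)^{\lambda_7}$, $[b,c]=(-1)^{\lambda_8}$, $[b,d]=(-1)^{\lambda_9}$, $[c,d]=(-1)^{\lambda_{10}}$. $C_i^4$ is a nonassociative code loop of rank $4$ having such generators with the stated characteristic vector. The orbit $O_i^4$ is the set of all vectors $\lambda_X(C_i^4)$ as $X=(a,b,c,d)$ runs over all such generating sets (with $(a,b,c)=-1$, $(d,L,L)=1$) of $C_i^4$. *)

theory Defs
  imports "Jordan_Normal_Form.VS_Connect" "HOL-Library.Z2"
begin

definition supp :: "bit vec \<Rightarrow> nat set" where
  "supp v = {i. i < dim_vec v \<and> v $ i = 1}"

definition double_even_code :: "nat \<Rightarrow> bit vec set \<Rightarrow> bool" where
  "double_even_code m V \<longleftrightarrow>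
     VectorSpace.subspace class_ring V (module_vec TYPE(bit) m) \<and>
     (\<forall>v\<in>V. 4 dvd card (supp v)) \<and>
     (\<forall>u\<in>V. \<forall>v\<in>V. 2 dvd card (supp u \<inter> supp v))"

definition code_dim :: "nat \<Rightarrow> bit vec set \<Rightarrow> nat" where
  "code_dim m V = vectorspace.dim class_ring (module_vec TYPE(bit) m\<lparr>carrier := V\<rparr>)"

definition factor_set :: "nat \<Rightarrow> bit vec set \<Rightarrow> (bit vec \<Rightarrow> bit vec \<Rightarrow> int) \<Rightarrow> bool" where
  "factor_set m V \<phi> \<longleftrightarrow>
     (\<forall>v\<in>V. \<forall>w\<in>V. \<phi> v w \<in> {1, -1}) \<and>
     (\<forall>v\<in>V. \<phi> v v = (-1) ^ (card (supp v) div 4)) \<and>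
     (\<forall>v\<in>V. \<forall>w\<in>V. \<phi> v w = (-1) ^ (card (supp v \<inter> supp w) div 2) * \<phi> w v) \<and>
     (\<forall>v\<in>V. \<phi> (0\<^sub>v m) v = 1 \<and> \<phi> v (0\<^sub>v m) = 1) \<and>
     (\<forall>v\<in>V. \<forall>w\<in>V. \<forall>u\<in>V. \<phi> (v + w) u =
        \<phi> v (w + u) * \<phi> v w * \<phi> w u * (-1) ^ card (supp v \<inter> supp w \<inter> supp u))"

text \<open>Loops use the \<^type>\<open>monoid\<close> record of HOL-Algebra merely as a signature, so that
  \<^const>\<open>hom\<close>, \<^const>\<open>iso\<close>, \<^const>\<open>is_iso\<close>, \<^const>\<open>m_inv\<close> and \<^const>\<open>FactGroup\<close>, whose definitions
  do not presuppose associativity, are available.\<close>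

locale alg_loop =
  fixes L :: "('a, 'b) monoid_scheme" (structure)
  assumes m_closed: "\<lbrakk>x \<in> carrier L; y \<in> carrier L\<rbrakk> \<Longrightarrow> x \<otimes> y \<in> carrier L"
    and one_closed: "\<one> \<in> carrier L"
    and l_one: "x \<in> carrier L \<Longrightarrow> \<one> \<otimes> x = x"
    and r_one: "x \<in> carrier L \<Longrightarrow> x \<otimes> \<one> = x"
    and l_div: "\<lbrakk>x \<in> carrier L; y \<in> carrier L\<rbrakk> \<Longrightarrow> \<exists>!z. z \<in> carrier L \<and> x \<otimes> z = y"
    and r_div: "\<lbrakk>x \<in> carrier L; y \<in> carrier L\<rbrakk> \<Longrightarrow> \<exists>!z. z \<in> carrier L \<and> z \<otimes> x = y"

definition loop_of_code ::
    "nat \<Rightarrow> bit vec set \<Rightarrow> (bit vec \<Rightarrow> bit vec \<Rightarrow> int) \<Rightarrow> (int \<times> bit vec) monoid" where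
  "loop_of_code m V \<phi> =
     \<lparr>carrier = {1, -1} \<times> V,
      mult = (\<lambda>(\<epsilon>, v) (\<delta>, w). (\<epsilon> * \<delta> * \<phi> v w, v + w)),
      one = (1, 0\<^sub>v m)\<rparr>"

definition code_loop_of_rank :: "nat \<Rightarrow> 'a monoid \<Rightarrow> bool" where
  "code_loop_of_rank n L \<longleftrightarrow> alg_loop L \<and>
     (\<exists>m V \<phi>. double_even_code m V \<and> factor_set m V \<phi> \<and> code_dim m V = n \<and>
        L \<cong> loop_of_code m V \<phi>)"

definition loop_comm :: "'a monoid \<Rightarrow> 'a \<Rightarrow> 'a \<Rightarrow> 'a" where
  "loop_comm L x y = (inv\<^bsub>L\<^esub> x \<otimes>\<^bsub>L\<^esub> inv\<^bsub>L\<^esub> y) \<otimes>\<^bsub>L\<^esub> (x \<otimes>\<^bsub>L\<^esub> y)"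

definition loop_assoc :: "'a monoid \<Rightarrow> 'a \<Rightarrow> 'a \<Rightarrow> 'a \<Rightarrow> 'a" where
  "loop_assoc L x y z =
     ((x \<otimes>\<^bsub>L\<^esub> y) \<otimes>\<^bsub>L\<^esub> z) \<otimes>\<^bsub>L\<^esub> inv\<^bsub>L\<^esub> (x \<otimes>\<^bsub>L\<^esub> (y \<otimes>\<^bsub>L\<^esub> z))"

definition nonassociative :: "'a monoid \<Rightarrow> bool" where
  "nonassociative L \<longleftrightarrow> (\<exists>x\<in>carrier L. \<exists>y\<in>carrier L. \<exists>z\<in>carrier L.
     (x \<otimes>\<^bsub>L\<^esub> y) \<otimes>\<^bsub>L\<^esub> z \<noteq> x \<otimes>\<^bsub>L\<^esub> (y \<otimes>\<^bsub>L\<^esub> z))"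

text \<open>The element \<open>-1\<close> of a code loop, transported along an isomorphism with some \<open>L(V)\<close>.
  For a nonassociative code loop it does not depend on the isomorphism, because it is the only
  nontrivial associator.  It is only used for such loops.\<close>

definition minus_one :: "'a monoid \<Rightarrow> 'a" where
  "minus_one L = (THE z. \<exists>m V \<phi> f. double_even_code m V \<and> factor_set m V \<phi> \<and>
     f \<in> iso L (loop_of_code m V \<phi>) \<and> z \<in> carrier L \<and> f z = (-1, 0\<^sub>v m))"

definition sign_pow :: "'a monoid \<Rightarrow> bit \<Rightarrow> 'a" where
  "sign_pow L e = (if e = 0 then \<one>\<^bsub>L\<^esub> else minus_one L)"

abbreviation pm_one :: "'a monoid \<Rightarrow> 'a set" where
  "pm_one L \<equiv> {\<one>\<^bsub>L\<^esub>, minus_one L}"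

text \<open>The quotient \<open>L / {1, -1}\<close>, an elementary abelian 2-group, as a vector space over the
  two-element field.  The fields \<open>mult\<close> and \<open>one\<close> of the module record are irrelevant.\<close>

definition quotient_space :: "'a monoid \<Rightarrow> (bit, 'a set) module" where
  "quotient_space L =
     \<lparr>carrier = carrier (L Mod pm_one L),
      mult = undefined,
      one = undefined,
      zero = \<one>\<^bsub>L Mod pm_one L\<^esub>,
      add = mult (L Mod pm_one L),
      smult = (\<lambda>k A. if k = 0 then \<one>\<^bsub>L Mod pm_one L\<^esub> else A)\<rparr>"

definition generators4 :: "'a monoid \<Rightarrow> 'a \<times> 'a \<times> 'a \<times> 'a \<Rightarrow> bool" where
  "generators4 L = (\<lambda>(a, b, c, d).
     {a, b, c, d} \<subseteq> carrier L \<and>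
     distinct (map (\<lambda>x. pm_one L #>\<^bsub>L\<^esub> x) [a, b, c, d]) \<and>
     vectorspace.basis class_ring (quotient_space L)
       (set (map (\<lambda>x. pm_one L #>\<^bsub>L\<^esub> x) [a, b, c, d])) \<and>
     loop_assoc L a b c = minus_one L \<and>
     (\<forall>x\<in>carrier L. \<forall>y\<in>carrier L. loop_assoc L d x y = \<one>\<^bsub>L\<^esub>))"

definition is_char_vector :: "'a monoid \<Rightarrow> 'a \<times> 'a \<times> 'a \<times> 'a \<Rightarrow> bit vec \<Rightarrow> bool" where
  "is_char_vector L = (\<lambda>(a, b, c, d) l. l \<in> carrier_vec 10 \<and>
     a \<otimes>\<^bsub>L\<^esub> a = sign_pow L (l $ 0) \<and>
     b \<otimes>\<^bsub>L\<^esub> b = sign_pow L (l $ 1) \<and>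
     c \<otimes>\<^bsub>L\<^esub> c = sign_pow L (l $ 2) \<and>
     d \<otimes>\<^bsub>L\<^esub> d = sign_pow L (l $ 3) \<and>
     loop_comm L a b = sign_pow L (l $ 4) \<and>
     loop_comm L a c = sign_pow L (l $ 5) \<and>
     loop_comm L a d = sign_pow L (l $ 6) \<and>
     loop_comm L b c = sign_pow L (l $ 7) \<and>
     loop_comm L b d = sign_pow L (l $ 8) \<and>
     loop_comm L c d = sign_pow L (l $ 9))"

definition char_orbit :: "'a monoid \<Rightarrow> bit vec set" where
  "char_orbit L = {l. \<exists>X. generators4 L X \<and> is_char_vector L X l}"

definition char_list :: "bit list list" where
  "char_list =
    [[1,1,1,0,1,1,0,1,0,0],
     [0,0,0,0,0,0,0,0,0,0],
     [0,0,0,0,1,1,0,1,0,0],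
     [0,0,1,0,1,0,0,0,0,0],
     [0,0,0,0,0,1,0,1,0,0],
     [1,1,1,1,1,1,0,1,0,0],
     [0,0,0,1,0,0,0,0,0,0],
     [0,0,0,0,0,0,1,0,0,0],
     [0,1,0,0,0,0,1,0,0,0],
     [0,0,0,1,1,1,1,0,0,0],
     [0,0,0,1,0,0,1,0,0,0],
     [0,0,0,0,0,0,1,1,0,0],
     [0,1,1,0,1,1,1,1,0,0],
     [0,0,0,1,0,0,1,1,0,0],
     [1,0,0,1,0,0,1,1,0,0],
     [0,0,0,1,1,1,1,1,0,0]]"

definition is_C4 :: "nat \<Rightarrow> 'a monoid \<Rightarrow> bool" where
  "is_C4 i L \<longleftrightarrow> code_loop_of_rank 4 L \<and> nonassociative L \<and>
     vec_of_list (char_list ! (i - 1)) \<in> char_orbit L"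

end

theory Submission
  imports Defs
begin

text \<open>For a doubly even code the functions \<open>|v|/4\<close>, \<open>|v \<inter> w|/2\<close> and \<open>|u \<inter> v \<inter> w|\<close> modulo 2 are a cubic
  form on \<open>V\<close>, its polarisation, and an alternating trilinear form; they give the squares,
  commutators and associators of the code loop.  In dimension 4 the trilinear form, if nonzero,
  has a radical spanned by a single vector \<open>d\<close>, so the admissible generators are the vectors
  \<open>(a, b, c, d)\<close> with \<open>a, b, c\<close> of trilinear value 1, and the characteristic vector lists the
  coefficients of the cubic form in this basis.  Two factor sets with the same cubic form differ by a
  coboundary, so the characteristic vector determines the loop.  Every vector of length 10
  occurs: a suitable code is assembled from columns, and a factor set is given by an explicit
  polynomial.  What remains is the action of the base changes on the 1024 cubic forms.  Elementary
  base changes generate from the 16 given vectors sets of the claimed sizes, which are disjoint because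
  two counting invariants separate the 16 forms; as the sizes add up to 1024, these sets are
  the orbits.\<close>

text \<open>A loop is given on an arbitrary type, and its element -1 by a description ranging over
  all isomorphisms with some \<open>L(V)\<close>. Fixing one such isomorphism turns an element into
  a codeword with a sign bit, and everything asked about the loop becomes a statement about
  codewords. Up to signs of the generators, a rank 4 loop has 8 * 168 = 1344 admissible generating
  tuples: \<open>a\<close>, \<open>b\<close>, \<open>c\<close> form a basis modulo the radical, each
  of them may be shifted by \<open>d\<close>, and \<open>d\<close> itself is forced. That the
  elementary base changes reach all of these is not proved group-theoretically. They only bound each
  orbit from below; the invariants keep the orbits apart, and the total 1024 leaves no gap in
  between. The obstacle is that the invariants are known to be constant only on the characteristic
  vectors of one and the same code. A bare vector therefore has to be realised by a code before two
  explored sets can be told apart, so the construction of codes serves the separation of the orbits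
  as well as the existence of the loops.\<close>

text \<open>By default the simplifier turns sums and products of bits into bit operations, which
  blocks ring normalisation.\<close>

declare add_bit_eq_xor [simp del] mult_bit_eq_and [simp del]

section \<open>Weight forms of a doubly even code\<close>

lemma UNIV_bit: "(UNIV :: bit set) = {0, 1}"
  by (auto intro: bit_not_zero_iff[THEN iffD1])

lemma card_UNIV_bit: "card (UNIV :: bit set) = 2"
  by (simp add: UNIV_bit)

lemma finite_UNIV_bit [simp]: "finite (UNIV :: bit set)"
  by (simp add: UNIV_bit)

lemma bit_of_nat: "(of_nat n :: bit) = of_bool (odd n)"
  by (induction n) auto

lemma bit_add_self: "(x::bit) + x = 0"
  by (cases x) auto

lemma bit_add_self_left: "(x::bit) + (x + y) = y"
  by (cases x; cases y) auto

lemma bit_add_move: "x + z = y \<Longrightarrow> x = y + (z::bit)"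
  by (cases x; cases y; cases z) auto

lemmas bit_ac = add.assoc add.commute add.left_commute bit_add_self bit_add_self_left

lemma bit_eq_iff_add: "x = y \<longleftrightarrow> x + y = (0::bit)"
  by (cases x; cases y) auto

text \<open>The character from bits to signs; through it the multiplicative laws of a factor set
  become linear identities over the two-element field.\<close>

definition bsign :: "bit \<Rightarrow> int" where
  "bsign b = (if b = 0 then 1 else - 1)"

lemma bsign_simps [simp]: "bsign 0 = 1" "bsign 1 = - 1"
  by (auto simp: bsign_def)

lemma bsign_eq_iff [simp]: "bsign a = bsign b \<longleftrightarrow> a = b"
  by (cases a; cases b) auto

lemma bsign_eq_1_iff [simp]: "bsign a = 1 \<longleftrightarrow> a = 0"
  by (cases a) auto

lemma bsign_add: "bsign (a + b) = bsign a * bsign b"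
  by (cases a; cases b) auto

lemma bsign_mem [simp]: "bsign a = 1 \<or> bsign a = - 1"
  by (cases a) auto

lemma bsign_of_nat: "(- 1) ^ n = bsign (of_nat n)"
  by (auto simp: bit_of_nat bsign_def)

lemma sign_eq_bsign: "\<epsilon> = 1 \<or> \<epsilon> = - 1 \<Longrightarrow> \<exists>b. \<epsilon> = bsign b"
  by (metis bsign_simps)

text \<open>Inclusion-exclusion without subtraction of natural numbers. The addition laws of the
  three weight forms are this equation divided by 4, divided by 2, and reduced modulo 2.\<close>

lemma card_sym_diff:
  assumes "finite A" "finite B"
  shows "card ((A - B) \<union> (B - A)) + 2 * card (A \<inter> B) = card A + card B"
proof -
  have "card ((A - B) \<union> (B - A)) = card (A - B) + card (B - A)"
    using assms by (intro card_Un_disjoint) auto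
  moreover have "card A = card (A - B) + card (A \<inter> B)"
    using card_Int_Diff[OF assms(1), of B] by simp
  moreover have "card B = card (B - A) + card (A \<inter> B)"
    using card_Int_Diff[OF assms(2), of A] by (simp add: Int_commute)
  ultimately show ?thesis by simp
qed

lemma finite_supp [simp]: "finite (supp v)"
  by (auto simp: supp_def)

lemma supp_zero [simp]: "supp (0\<^sub>v m) = {}"
  by (auto simp: supp_def)

lemma supp_add:
  assumes "v \<in> carrier_vec m" "w \<in> carrier_vec m"
  shows "supp (v + w) = (supp v - supp w) \<union> (supp w - supp v)"
proof -
  have *: "x + y = 1 \<longleftrightarrow> (x = 1) \<noteq> (y = 1)" for x y :: bit
    by (cases x; cases y) simp_all
  show ?thesis using assms by (auto simp: supp_def *)
qed

definition wt_form :: "bit vec \<Rightarrow> bit" where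
  "wt_form v = of_nat (card (supp v) div 4)"

definition wt_form2 :: "bit vec \<Rightarrow> bit vec \<Rightarrow> bit" where
  "wt_form2 v w = of_nat (card (supp v \<inter> supp w) div 2)"

definition wt_form3 :: "bit vec \<Rightarrow> bit vec \<Rightarrow> bit vec \<Rightarrow> bit" where
  "wt_form3 u v w = of_nat (card (supp u \<inter> supp v \<inter> supp w))"

locale even_code =
  fixes m :: nat and V :: "bit vec set"
  assumes code: "double_even_code m V"
begin

lemma carrier: "v \<in> V \<Longrightarrow> v \<in> carrier_vec m"
  using code by (auto simp: double_even_code_def VectorSpace.subspace_def submodule_def module_vec_simps)

lemma dim [simp]: "v \<in> V \<Longrightarrow> dim_vec v = m"
  using carrier by auto

lemma zero_closed [simp]: "0\<^sub>v m \<in> V"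
  using code by (auto simp: double_even_code_def VectorSpace.subspace_def submodule_def module_vec_simps)

lemma add_closed [simp]: "v \<in> V \<Longrightarrow> w \<in> V \<Longrightarrow> v + w \<in> V"
  using code by (auto simp: double_even_code_def VectorSpace.subspace_def submodule_def module_vec_simps)

lemma smult_closed [simp]: "v \<in> V \<Longrightarrow> x \<cdot>\<^sub>v v \<in> V"
  using code by (auto simp: double_even_code_def VectorSpace.subspace_def submodule_def module_vec_simps)

lemma add_0 [simp]: "v \<in> V \<Longrightarrow> 0\<^sub>v m + v = v" "v \<in> V \<Longrightarrow> v + 0\<^sub>v m = v"
  using carrier by auto

lemma add_self [simp]: "v \<in> V \<Longrightarrow> v + v = 0\<^sub>v m"
  using carrier by (intro eq_vecI) (auto simp: bit_add_self)

lemma add_comm: "v \<in> V \<Longrightarrow> w \<in> V \<Longrightarrow> v + w = w + v"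
  using carrier by (auto intro: comm_add_vec)

lemma add_assoc: "u \<in> V \<Longrightarrow> v \<in> V \<Longrightarrow> w \<in> V \<Longrightarrow> (u + v) + w = u + (v + w)"
  using carrier by (auto intro: assoc_add_vec)

lemma add_left_comm: "u \<in> V \<Longrightarrow> v \<in> V \<Longrightarrow> w \<in> V \<Longrightarrow> u + (v + w) = v + (u + w)"
  by (metis add_assoc add_comm)

lemma add_self_left: "u \<in> V \<Longrightarrow> v \<in> V \<Longrightarrow> u + (u + v) = v"
  by (metis add_assoc add_self add_0(1))

lemmas V_ac = add_assoc add_comm add_left_comm add_self_left

lemma add_left_cancel: "u \<in> V \<Longrightarrow> v \<in> V \<Longrightarrow> w \<in> V \<Longrightarrow> u + v = u + w \<longleftrightarrow> v = w"
  by (metis add_self_left)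

lemma finite_V: "finite V"
proof (rule finite_subset)
  show "V \<subseteq> vec_of_list ` {xs. set xs \<subseteq> UNIV \<and> length xs = m}"
  proof
    fix v assume "v \<in> V"
    then have "v = vec_of_list (list_of_vec v)" "length (list_of_vec v) = m"
      by (auto simp: vec_list)
    then show "v \<in> vec_of_list ` {xs. set xs \<subseteq> UNIV \<and> length xs = m}" by blast
  qed
  show "finite (vec_of_list ` {xs :: bit list. set xs \<subseteq> UNIV \<and> length xs = m})"
    by (intro finite_imageI finite_lists_length_eq finite_UNIV_bit)
qed

lemma card4: "v \<in> V \<Longrightarrow> card (supp v) = 4 * (card (supp v) div 4)"
  using code by (auto simp: double_even_code_def)

lemma card2: "v \<in> V \<Longrightarrow> w \<in> V \<Longrightarrow>
    card (supp v \<inter> supp w) = 2 * (card (supp v \<inter> supp w) div 2)"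
  using code by (auto simp: double_even_code_def)

lemma form_zero [simp]: "wt_form (0\<^sub>v m) = 0" "wt_form2 (0\<^sub>v m) v = 0" "wt_form2 v (0\<^sub>v m) = 0"
    "wt_form3 (0\<^sub>v m) v w = 0" "wt_form3 v (0\<^sub>v m) w = 0" "wt_form3 v w (0\<^sub>v m) = 0"
  by (auto simp: wt_form_def wt_form2_def wt_form3_def)

text \<open>Weights are multiples of 4 and intersections are even, so inclusion-exclusion divides by
  4 without remainder: \<open>wt_form2\<close> is the polarisation of
  \<open>wt_form\<close>.\<close>

lemma form_add:
  assumes "v \<in> V" "w \<in> V"
  shows "wt_form (v + w) = wt_form v + wt_form w + wt_form2 v w"
proof -
  have "card (supp (v + w)) + 2 * card (supp v \<inter> supp w) = card (supp v) + card (supp w)"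
    using assms carrier by (simp add: supp_add[of _ m] card_sym_diff)
  then have "card (supp (v + w)) div 4 + card (supp v \<inter> supp w) div 2
      = card (supp v) div 4 + card (supp w) div 4"
    using card4[OF assms(1)] card4[OF assms(2)] card4[OF add_closed[OF assms]] card2[OF assms]
    by linarith
  then have "wt_form (v + w) + wt_form2 v w = wt_form v + wt_form w"
    unfolding wt_form_def wt_form2_def of_nat_add[symmetric] by simp
  then show ?thesis by (rule bit_add_move)
qed

lemma form2_sym: "wt_form2 v w = wt_form2 w v"
  by (simp add: wt_form2_def Int_commute)

lemma form2_self [simp]:
  assumes "v \<in> V"
  shows "wt_form2 v v = 0"
proof -
  obtain k where "card (supp v) = 4 * k"
    using card4[OF assms] by blast
  then have "card (supp v) div 2 = 2 * k" by simp
  then show ?thesis by (simp add: wt_form2_def bit_of_nat)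
qed

text \<open>Inclusion-exclusion inside \<open>supp w\<close>, divided by 2. The triple intersection
  is left over and measures the failure of additivity.\<close>

lemma form2_add_left:
  assumes "u \<in> V" "v \<in> V" "w \<in> V"
  shows "wt_form2 (u + v) w = wt_form2 u w + wt_form2 v w + wt_form3 u v w"
proof -
  let ?U = "supp u \<inter> supp w" and ?W = "supp v \<inter> supp w"
  have "supp (u + v) \<inter> supp w = (?U - ?W) \<union> (?W - ?U)" 
    using supp_add[of u m v] assms carrier by auto
  moreover have "?U \<inter> ?W = supp u \<inter> supp v \<inter> supp w" by auto
  ultimately have "card (supp (u + v) \<inter> supp w) + 2 * card (supp u \<inter> supp v \<inter> supp w) = card ?U + card ?W"
    by (metis card_sym_diff finite_Int finite_supp)
  then have "card (supp (u + v) \<inter> supp w) div 2 + card (supp u \<inter> supp v \<inter> supp w)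
      = card ?U div 2 + card ?W div 2"
    using card2[OF add_closed[OF assms(1,2)] assms(3)] card2[OF assms(1,3)] card2[OF assms(2,3)]
    by linarith
  then have "wt_form2 (u + v) w + wt_form3 u v w = wt_form2 u w + wt_form2 v w"
    unfolding wt_form3_def wt_form2_def of_nat_add[symmetric] by simp
  then show ?thesis by (rule bit_add_move)
qed

lemma form2_add_right:
  assumes "u \<in> V" "v \<in> V" "w \<in> V"
  shows "wt_form2 w (u + v) = wt_form2 w u + wt_form2 w v + wt_form3 u v w"
  using form2_add_left[OF assms] by (simp add: form2_sym)

lemma form3_perm: "wt_form3 u v w = wt_form3 v u w" "wt_form3 u v w = wt_form3 u w v"
  by (simp_all add: wt_form3_def Int_commute Int_left_commute Int_assoc)

lemma form3_self [simp]:
  assumes "v \<in> V" "w \<in> V"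
  shows "wt_form3 v v w = 0" "wt_form3 v w v = 0" "wt_form3 w v v = 0"
proof -
  show "wt_form3 v v w = 0"
    using card2[OF assms] unfolding wt_form3_def bit_of_nat Int_absorb
    by (metis dvd_triv_left of_bool_eq(1))
  then show "wt_form3 v w v = 0" "wt_form3 w v v = 0"
    by (metis form3_perm)+
qed

text \<open>One degree further the correction term carries a factor 2 and vanishes in the field, so
  polarisation ends here.\<close>

lemma form3_add:
  assumes "u \<in> V" "u' \<in> V" 
  shows "wt_form3 (u + u') v w = wt_form3 u v w + wt_form3 u' v w"
    "wt_form3 v (u + u') w = wt_form3 v u w + wt_form3 v u' w"
    "wt_form3 v w (u + u') = wt_form3 v w u + wt_form3 v w u'"
proof -
  show *: "wt_form3 (u + u') v w = wt_form3 u v w + wt_form3 u' v w" for v w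
  proof -
    let ?S = "supp v \<inter> supp w"
    let ?U = "supp u \<inter> ?S" and ?W = "supp u' \<inter> ?S"
    have "supp (u + u') \<inter> ?S = (?U - ?W) \<union> (?W - ?U)" 
      using supp_add[of u m u'] assms carrier by auto
    then have "card (supp (u + u') \<inter> ?S) + 2 * card (?U \<inter> ?W) = card ?U + card ?W"
      by (simp add: card_sym_diff)
    then have "(of_nat (card (supp (u + u') \<inter> ?S) + 2 * card (?U \<inter> ?W)) :: bit)
        = of_nat (card ?U + card ?W)" by (rule arg_cong)
    then show ?thesis
      unfolding wt_form3_def by (simp add: Int_assoc)
  qed
  show "wt_form3 v (u + u') w = wt_form3 v u w + wt_form3 v u' w"
    using *[of v w] by (metis form3_perm(1))
  show "wt_form3 v w (u + u') = wt_form3 v w u + wt_form3 v w u'"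
    using *[of v w] by (metis form3_perm)
qed

end

section \<open>Bases of vector spaces over the two-element field\<close>

lemma bij_betw_iff_ex1:
  assumes "\<And>x. x \<in> S \<Longrightarrow> g x \<in> T"
  shows "bij_betw g S T \<longleftrightarrow> (\<forall>y\<in>T. \<exists>!x. x \<in> S \<and> g x = y)"
proof
  assume "bij_betw g S T"
  then show "\<forall>y\<in>T. \<exists>!x. x \<in> S \<and> g x = y"
    unfolding bij_betw_def inj_on_def by blast
next
  assume *: "\<forall>y\<in>T. \<exists>!x. x \<in> S \<and> g x = y"
  have "inj_on g S"
  proof (rule inj_onI)
    fix x y assume "x \<in> S" "y \<in> S" "g x = g y"
    moreover from this have "\<exists>!z. z \<in> S \<and> g z = g y"
      using * assms by blast
    ultimately show "x = y" by blast
  qed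
  moreover have "g ` S = T"
    using * assms by blast
  ultimately show "bij_betw g S T" by (simp add: bij_betw_def)
qed

text \<open>Coordinates with respect to a basis exist and are unique. They are taken as extensional
  functions because \<open>lincomb\<close> sees only the values on \<open>A\<close>.\<close>

lemma basis_iff_bij_lincomb:
  fixes W :: "(bit, 'a, 'c) module_scheme"
  assumes "vectorspace class_ring W" "finite A" "A \<subseteq> carrier W"
  shows "vectorspace.basis class_ring W A \<longleftrightarrow>
    bij_betw (\<lambda>f. module.lincomb W f A) (A \<rightarrow>\<^sub>E UNIV) (carrier W)"
proof -
  interpret vectorspace "class_ring :: bit ring" W by fact
  have "lincomb f A \<in> carrier W" for f
    using assms(2,3) by (intro lincomb_closed) auto
  then have bij: "bij_betw (\<lambda>f. lincomb f A) (A \<rightarrow>\<^sub>E UNIV) (carrier W) \<longleftrightarrow>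
      (\<forall>v\<in>carrier W. \<exists>!f. f \<in> A \<rightarrow>\<^sub>E UNIV \<and> lincomb f A = v)"
    by (intro bij_betw_iff_ex1)
  have "basis A \<longleftrightarrow> (\<forall>v\<in>carrier W. \<exists>!f. f \<in> A \<rightarrow>\<^sub>E UNIV \<and> lincomb f A = v)"
    using basis_criterion[OF assms(2,3)] unfolding Ball_def partial_object.simps .
  then show ?thesis using bij by (rule trans[OF _ sym])
qed

lemma card_bit_space:
  fixes W :: "(bit, 'a, 'c) module_scheme"
  assumes "vectorspace class_ring W" "finite (carrier W)"
  shows "card (carrier W) = 2 ^ vectorspace.dim class_ring W"
proof -
  interpret vectorspace "class_ring :: bit ring" W by fact
  have "gen_set (carrier W)"
    using in_own_span[of "carrier W"] span_is_subset2[of "carrier W"] by auto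
  then have fin_dim
    using assms(2) unfolding fin_dim_def by blast
  then obtain A where A: "finite A" "basis A" using finite_basis_exists by auto
  then have "A \<subseteq> carrier W" by (simp add: basis_def)
  then have bij: "bij_betw (\<lambda>f. lincomb f A) (A \<rightarrow>\<^sub>E UNIV) (carrier W)"
    using basis_iff_bij_lincomb[OF assms(1)] A by auto
  then have "card (carrier W) = card (A \<rightarrow>\<^sub>E (UNIV :: bit set))"
    by (metis bij_betw_same_card)
  then show ?thesis
    using dim_basis[OF A] A(1) by (simp add: card_PiE card_UNIV_bit)
qed

definition comb4 :: "(bit, 'a, 'c) module_scheme \<Rightarrow> 'a \<Rightarrow> 'a \<Rightarrow> 'a \<Rightarrow> 'a \<Rightarrow> bit \<times> bit \<times> bit \<times> bit \<Rightarrow> 'a" where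
  "comb4 W a b c d = (\<lambda>(x, y, z, t).
     (x \<odot>\<^bsub>W\<^esub> a) \<oplus>\<^bsub>W\<^esub> ((y \<odot>\<^bsub>W\<^esub> b) \<oplus>\<^bsub>W\<^esub> ((z \<odot>\<^bsub>W\<^esub> c) \<oplus>\<^bsub>W\<^esub> (t \<odot>\<^bsub>W\<^esub> d))))"

text \<open>A basis is a set while generators come as a tuple; \<open>dist\<close> ensures that no
  entry is lost in passing from the tuple to the set.\<close>

lemma basis4_iff:
  fixes W :: "(bit, 'a, 'c) module_scheme"
  assumes W: "vectorspace class_ring W" and dist: "distinct [a, b, c, d]"
    and sub: "{a, b, c, d} \<subseteq> carrier W"
  shows "vectorspace.basis class_ring W {a, b, c, d} \<longleftrightarrow>
    bij_betw (comb4 W a b c d) UNIV (carrier W)"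
proof -
  interpret vectorspace "class_ring :: bit ring" W by fact
  let ?A = "{a, b, c, d}"
  have neq: "b \<noteq> a" "c \<noteq> a" "d \<noteq> a" "c \<noteq> b" "d \<noteq> b" "d \<noteq> c"
    using dist by auto
  define e :: "bit \<times> bit \<times> bit \<times> bit \<Rightarrow> 'a \<Rightarrow> bit" where
    "e = (\<lambda>(x, y, z, t). restrict (\<lambda>v. if v = a then x else if v = b then y else if v = c then z else t) ?A)"
  have bij: "bij_betw e UNIV (?A \<rightarrow>\<^sub>E UNIV)"
  proof (rule bij_betw_byWitness[where f' = "\<lambda>f. (f a, f b, f c, f d)"])
    show "\<forall>x\<in>UNIV. (e x a, e x b, e x c, e x d) = x"
      using dist by (auto simp: e_def)
    show "\<forall>f\<in>?A \<rightarrow>\<^sub>E UNIV. e (f a, f b, f c, f d) = f"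
      by (auto simp: e_def fun_eq_iff restrict_def PiE_def extensional_def split: if_splits)
  qed (auto simp: e_def split: if_splits)
  have "lincomb (e x) ?A = comb4 W a b c d x" for x
  proof -
    obtain x1 x2 x3 x4 where x: "x = (x1, x2, x3, x4)" by (metis prod.exhaust)
    show ?thesis
      using dist neq sub by (simp add: x lincomb_def e_def comb4_def)
  qed
  then have "(\<lambda>f. lincomb f ?A) \<circ> e = comb4 W a b c d"
    by (auto simp: fun_eq_iff)
  then show ?thesis
    using basis_iff_bij_lincomb[OF W _ sub] bij_betw_comp_iff[OF bij, of "\<lambda>f. lincomb f ?A" "carrier W"]
    by auto
qed

section \<open>Adapted bases and coboundaries\<close>

type_synonym bit4 = "bit \<times> bit \<times> bit \<times> bit"
type_synonym bit10 = "bit \<times> bit \<times> bit \<times> bit \<times> bit \<times> bit \<times> bit \<times> bit \<times> bit \<times> bit"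

fun add4 :: "bit4 \<Rightarrow> bit4 \<Rightarrow> bit4" where
  "add4 (x1, x2, x3, x4) (y1, y2, y3, y4) = (x1 + y1, x2 + y2, x3 + y3, x4 + y4)"

text \<open>The coefficient of \<open>x * y * z\<close> is 1 because \<open>a\<close>,
  \<open>b\<close>, \<open>c\<close> have trilinear value 1, and no other cubic monomial occurs
  because \<open>d\<close> lies in the radical. The other ten coefficients follow the order of the
  characteristic vector.\<close>

fun cubic :: "bit10 \<Rightarrow> bit4 \<Rightarrow> bit" where
  "cubic (l1, l2, l3, l4, l5, l6, l7, l8, l9, l10) (x, y, z, t) =
     l1 * x + l2 * y + l3 * z + l4 * t + l5 * (x * y) + l6 * (x * z) + l7 * (x * t)
     + l8 * (y * z) + l9 * (y * t) + l10 * (z * t) + x * y * z"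

lemma finite_UNIV_bit4 [simp]: "finite (UNIV :: bit4 set)"
  by (simp flip: UNIV_Times_UNIV)

lemma finite_UNIV_bit10: "finite (UNIV :: bit10 set)"
  by (simp flip: UNIV_Times_UNIV)

lemma card_UNIV_bit4: "card (UNIV :: bit4 set) = 16"
  by (simp add: card_UNIV_bit card_cartesian_product flip: UNIV_Times_UNIV)

lemma card_UNIV_bit3: "card (UNIV :: (bit \<times> bit \<times> bit) set) = 8"
  by (simp add: card_UNIV_bit card_cartesian_product flip: UNIV_Times_UNIV)

context even_code
begin

lemma smult_simps [simp]: "v \<in> V \<Longrightarrow> 0 \<cdot>\<^sub>v v = 0\<^sub>v m" "v \<in> V \<Longrightarrow> 1 \<cdot>\<^sub>v v = v"
  using carrier by (auto intro!: eq_vecI)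

definition comb :: "bit vec \<Rightarrow> bit vec \<Rightarrow> bit vec \<Rightarrow> bit vec \<Rightarrow> bit4 \<Rightarrow> bit vec" where
  "comb a b c d = (\<lambda>(x, y, z, t). x \<cdot>\<^sub>v a + (y \<cdot>\<^sub>v b + (z \<cdot>\<^sub>v c + t \<cdot>\<^sub>v d)))"

text \<open>Linear independence is a consequence of these conditions, by \<open>inj_comb\<close>; in
  a code with 16 words a frame is thus a basis.\<close>

definition frame :: "bit vec \<Rightarrow> bit vec \<Rightarrow> bit vec \<Rightarrow> bit vec \<Rightarrow> bool" where
  "frame a b c d \<longleftrightarrow> a \<in> V \<and> b \<in> V \<and> c \<in> V \<and> d \<in> V \<and> wt_form3 a b c = 1 \<and> d \<noteq> 0\<^sub>v m \<and>
     (\<forall>x\<in>V. \<forall>y\<in>V. wt_form3 d x y = 0)"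

definition char_tuple :: "bit vec \<Rightarrow> bit vec \<Rightarrow> bit vec \<Rightarrow> bit vec \<Rightarrow> bit10" where
  "char_tuple a b c d = (wt_form a, wt_form b, wt_form c, wt_form d, wt_form2 a b, wt_form2 a c,
     wt_form2 a d, wt_form2 b c, wt_form2 b d, wt_form2 c d)"

definition char_tuples :: "bit10 set" where
  "char_tuples = {char_tuple a b c d | a b c d. frame a b c d}"

lemma form3_smult [simp]: "a \<in> V \<Longrightarrow> wt_form3 (x \<cdot>\<^sub>v a) v w = x * wt_form3 a v w"
  by (cases x) auto

lemma comb_closed: "a \<in> V \<Longrightarrow> b \<in> V \<Longrightarrow> c \<in> V \<Longrightarrow> d \<in> V \<Longrightarrow> comb a b c d x \<in> V"
  by (auto simp: comb_def split: prod.splits)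

lemma comb_add:
  assumes "a \<in> V" "b \<in> V" "c \<in> V" "d \<in> V"
  shows "comb a b c d x + comb a b c d y = comb a b c d (add4 x y)"
proof -
  obtain x1 x2 x3 x4 y1 y2 y3 y4 where xy: "x = (x1, x2, x3, x4)" "y = (y1, y2, y3, y4)"
    by (metis prod.exhaust)
  show ?thesis
    using assms by (intro eq_vecI) (auto simp: comb_def xy algebra_simps)
qed

text \<open>Pairing a combination with two of \<open>a\<close>, \<open>b\<close>, \<open>c\<close>
  reads off the coordinate at the third; \<open>d \<noteq> 0\<^sub>v m\<close> then yields the last
  one. Only three values of the trilinear form at \<open>d\<close> enter, so the lemma applies
  before \<open>d\<close> is known to lie in the radical.\<close>

lemma inj_comb:
  assumes V: "a \<in> V" "b \<in> V" "c \<in> V" "d \<in> V" and d: "d \<noteq> 0\<^sub>v m"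
    and T: "wt_form3 a b c = 1" "wt_form3 d a b = 0" "wt_form3 d a c = 0" "wt_form3 d b c = 0"
  shows "inj (comb a b c d)"
proof (rule injI)
  fix x y assume eq: "comb a b c d x = comb a b c d y"
  obtain x1 x2 x3 x4 y1 y2 y3 y4 where xy: "x = (x1, x2, x3, x4)" "y = (y1, y2, y3, y4)"
    by (metis prod.exhaust)
  have T': "wt_form3 b a c = 1" "wt_form3 c a b = 1"
    using T(1) by (metis form3_perm)+
  have "wt_form3 (comb a b c d x) b c = wt_form3 (comb a b c d y) b c"
    "wt_form3 (comb a b c d x) a c = wt_form3 (comb a b c d y) a c"
    "wt_form3 (comb a b c d x) a b = wt_form3 (comb a b c d y) a b"
    by (simp_all add: eq)
  then have *: "x1 = y1" "x2 = y2" "x3 = y3"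
    using V T T' by (simp_all add: comb_def xy form3_add)
  then have "x4 \<cdot>\<^sub>v d = y4 \<cdot>\<^sub>v d"
    using eq V by (simp add: comb_def xy add_left_cancel)
  then have "x4 = y4"
    using d V(4) by (cases x4; cases y4) auto
  then show "x = y" using * by (simp add: xy)
qed

lemma bij_comb:
  assumes "inj (comb a b c d)" "a \<in> V" "b \<in> V" "c \<in> V" "d \<in> V" "card V = 16"
  shows "bij_betw (comb a b c d) UNIV V"
proof -
  have "range (comb a b c d) \<subseteq> V"
    using assms comb_closed by blast
  moreover have "card (range (comb a b c d)) = card V"
    using assms by (simp add: card_image card_UNIV_bit4)
  ultimately have "range (comb a b c d) = V"
    using finite_V by (simp add: card_subset_eq)
  then show ?thesis using assms by (simp add: bij_betw_def)
qed

lemma frame_bij: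
  assumes "frame a b c d" "card V = 16"
  shows "bij_betw (comb a b c d) UNIV V"
  using assms by (intro bij_comb inj_comb) (auto simp: frame_def)

text \<open>A cubic form is determined by its values on a basis, the polarisations of pairs and the
  trilinear values of triples. For a frame the last are fixed, and the first two are exactly the
  characteristic tuple.\<close>

lemma form_comb:
  assumes "frame a b c d"
  shows "wt_form (comb a b c d x) = cubic (char_tuple a b c d) x"
proof -
  have V [simp]: "a \<in> V" "b \<in> V" "c \<in> V" "d \<in> V" using assms by (auto simp: frame_def)
  have [simp]: "wt_form3 u v d = 0" "wt_form3 u d v = 0" "wt_form3 d u v = 0" if "u \<in> V" "v \<in> V" for u v
    using assms that unfolding frame_def by (metis form3_perm)+
  have [simp]: "wt_form3 b c a = 1" "wt_form3 c b a = 1"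
    using assms unfolding frame_def by (metis form3_perm)+
  obtain x1 x2 x3 x4 where x: "x = (x1, x2, x3, x4)" by (metis prod.exhaust)
  show ?thesis
    unfolding x comb_def char_tuple_def prod.case
    by (cases x1; cases x2; cases x3; cases x4)
      (simp_all add: form_add form2_add_right form3_add bit_ac)
qed

text \<open>By the pigeonhole principle two of the 16 codewords have the same values of the three linear
  functionals obtained by fixing two of the vectors \<open>a\<close>, \<open>b\<close>, \<open>c\<close>; their sum spans the radical.\<close>

lemma frame_exists:
  assumes V: "a \<in> V" "b \<in> V" "c \<in> V" and T: "wt_form3 a b c = 1" and card: "card V = 16"
  shows "\<exists>d. frame a b c d"
proof -
  let ?g = "\<lambda>v. (wt_form3 v a b, wt_form3 v a c, wt_form3 v b c)"
  have "card (?g ` V) \<le> card (UNIV :: (bit \<times> bit \<times> bit) set)"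
    by (rule card_mono[OF card_ge_0_finite subset_UNIV]) (simp add: card_UNIV_bit3)
  then have less: "card (?g ` V) < card V"
    unfolding card card_UNIV_bit3 by linarith
  have "\<not> inj_on ?g V"
  proof
    assume "inj_on ?g V"
    then have "card (?g ` V) = card V" by (rule card_image)
    with less show False by linarith
  qed
  then obtain v w where vw: "v \<in> V" "w \<in> V" "v \<noteq> w" "?g v = ?g w"
    unfolding inj_on_def by blast
  define d where "d = v + w"
  have d [simp]: "d \<in> V" "d \<noteq> 0\<^sub>v m"
    using vw add_left_cancel[of v w v] add_self[of v] unfolding d_def by (auto simp del: add_self)
  have T0: "wt_form3 d a b = 0" "wt_form3 d a c = 0" "wt_form3 d b c = 0"
    using vw by (auto simp: d_def form3_add bit_add_self)
  then have T0': "wt_form3 d b a = 0" "wt_form3 d c a = 0" "wt_form3 d c b = 0"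
    by (metis form3_perm(2))+
  have bij: "bij_betw (comb a b c d) UNIV V"
    using V T T0 card by (intro bij_comb inj_comb) auto
  then have range: "V = range (comb a b c d)"
    by (simp add: bij_betw_def)
  have coords: "\<exists>x1 x2 x3 x4. v = comb a b c d (x1, x2, x3, x4)" if "v \<in> V" for v
    using that unfolding range by auto
  \<comment> \<open>Since \<open>a\<close>, \<open>b\<close>, \<open>c\<close>, \<open>d\<close>
    span \<open>V\<close>, trilinearity reduces the claim to pairs of basis vectors; pairs
    containing \<open>d\<close>, and equal pairs, vanish because the form is alternating.\<close>
  have "wt_form3 d x y = 0" if xV: "x \<in> V" and yV: "y \<in> V" for x y
  proof -
    obtain x1 x2 x3 x4 where x: "x = comb a b c d (x1, x2, x3, x4)"
      using coords[OF xV] by blast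
    obtain y1 y2 y3 y4 where y: "y = comb a b c d (y1, y2, y3, y4)"
      using coords[OF yV] by blast
    have sm: "wt_form3 u (s \<cdot>\<^sub>v v) w = s * wt_form3 u v w"
         "wt_form3 u w (s \<cdot>\<^sub>v v) = s * wt_form3 u w v" if "v \<in> V" for u v w s
      using form3_smult[OF that] by (metis form3_perm)+
    show ?thesis
      using V T0 T0' by (simp add: x y comb_def form3_add sm)
  qed
  then have "frame a b c d"
    using V T d by (simp add: frame_def)
  then show ?thesis by blast
qed

text \<open>Enlarge a subgroup \<open>H\<close> on which \<open>\<chi>\<close> is the coboundary of \<open>t\<close> by one coset \<open>H + e\<close>,
  setting \<open>t (h + e) = t h + \<chi> h e\<close>.\<close>

lemma coboundary:
  assumes diag: "\<And>v. v \<in> V \<Longrightarrow> \<chi> v v = (0 :: bit)"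
    and chi_sym: "\<And>v w. v \<in> V \<Longrightarrow> w \<in> V \<Longrightarrow> \<chi> v w = \<chi> w v"
    and zero: "\<And>v. v \<in> V \<Longrightarrow> \<chi> (0\<^sub>v m) v = 0"
    and cocycle: "\<And>u v w. u \<in> V \<Longrightarrow> v \<in> V \<Longrightarrow> w \<in> V \<Longrightarrow>
      \<chi> (u + v) w + \<chi> u v = \<chi> u (v + w) + \<chi> v w"
  shows "\<exists>t. \<forall>v\<in>V. \<forall>w\<in>V. \<chi> v w = t v + t w + t (v + w)"
proof -
  define good where "good H \<longleftrightarrow> H \<subseteq> V \<and> 0\<^sub>v m \<in> H \<and> (\<forall>v\<in>H. \<forall>w\<in>H. v + w \<in> H) \<and>
     (\<exists>t. \<forall>v\<in>H. \<forall>w\<in>H. \<chi> v w = t v + t w + t (v + w))" for H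
  have "good {0\<^sub>v m}"
    by (auto simp: good_def zero bit_ac intro: exI[of _ "\<lambda>_. 0"])
  moreover have "good H \<Longrightarrow> card H < Suc (card V)" for H
    using finite_V by (auto simp: good_def le_imp_less_Suc card_mono)
  \<comment> \<open>A largest such subgroup exists since \<open>V\<close> is finite; an element
    outside it would allow an extension by one coset.\<close>
  ultimately obtain H where H: "good H" "\<And>H'. good H' \<Longrightarrow> card H' \<le> card H"
    using ex_has_greatest_nat[of good "{0\<^sub>v m}" card "Suc (card V)"] by metis
  then obtain t where t: "\<And>v w. v \<in> H \<Longrightarrow> w \<in> H \<Longrightarrow> \<chi> v w = t v + t w + t (v + w)"
    unfolding good_def by blast
  have HV: "v \<in> V" if "v \<in> H" for v using that H(1) by (auto simp: good_def)
  have H0: "0\<^sub>v m \<in> H" and Hadd: "\<And>v w. v \<in> H \<Longrightarrow> w \<in> H \<Longrightarrow> v + w \<in> H"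
    using H(1) by (auto simp: good_def)
  have "V \<subseteq> H"
  proof
    fix e assume e: "e \<in> V"
    show "e \<in> H"
    proof (rule ccontr)
      assume "e \<notin> H"
      have notin: "h + e \<notin> H" if "h \<in> H" for h
      proof
        assume "h + e \<in> H"
        then have "h + (h + e) \<in> H" using Hadd that by blast
        then show False using \<open>e \<notin> H\<close> add_self_left[of h e] HV[OF that] e by simp
      qed
      define K where "K = H \<union> (\<lambda>h. h + e) ` H"
      define t' where "t' v = (if v \<in> H then t v else t (v + e) + \<chi> (v + e) e)" for v
      have t'H: "t' h = t h" if "h \<in> H" for h using that by (simp add: t'_def)
      have he: "(h + e) + e = h" if "h \<in> H" for h
        using HV[OF that] e by (simp add: add_assoc)
      have t'e: "t' (h + e) = t h + \<chi> h e" if "h \<in> H" for h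
        using notin[OF that] he[OF that] by (simp add: t'_def)
      have ee: "(h + e) + (k + e) = h + k" "(h + e) + k = (h + k) + e" "h + (k + e) = (h + k) + e"
        if "h \<in> H" "k \<in> H" for h k
        using HV[OF that(1)] HV[OF that(2)] e by (simp_all add: V_ac)
      have c1: "\<chi> h (k + e) = t' h + t' (k + e) + t' (h + (k + e))" if h: "h \<in> H" "k \<in> H" for h k
      proof -
        have "\<chi> (h + k) e + \<chi> h k = \<chi> h (k + e) + \<chi> k e"
          using HV h e by (intro cocycle) auto
        then have "\<chi> h (k + e) = \<chi> (h + k) e + \<chi> h k + \<chi> k e"
          by (rule bit_add_move[OF sym])
        then show ?thesis
          unfolding ee(3)[OF h] t'e[OF h(2)] t'e[OF Hadd[OF h]] t'H[OF h(1)] t[OF h]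
          by (simp add: bit_ac)
      qed
      \<comment> \<open>Both arguments lie in the new coset. The cocycle law for \<open>h\<close>,
        \<open>e\<close>, \<open>k + e\<close> produces \<open>\<chi> e (k + e)\<close>, which the
        law for \<open>e\<close>, \<open>e\<close>, \<open>k\<close> turns into
        \<open>\<chi> k e\<close>. The vanishing diagonal enters here, as
        \<open>\<chi> e e = 0\<close>.\<close>
      have c2: "\<chi> (h + e) (k + e) = t' (h + e) + t' (k + e) + t' ((h + e) + (k + e))"
        if h: "h \<in> H" "k \<in> H" for h k
      proof -
        have "\<chi> (h + e) (k + e) + \<chi> h e = \<chi> h (e + (k + e)) + \<chi> e (k + e)"
          using HV h e by (intro cocycle) auto
        moreover have "e + (k + e) = k" using HV[OF h(2)] e by (simp add: V_ac)
        moreover have "\<chi> (e + e) k + \<chi> e e = \<chi> e (e + k) + \<chi> e k"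
          using HV h e by (intro cocycle) auto
        moreover have "\<chi> (e + e) k = 0" "\<chi> e e = 0" using zero diag HV[OF h(2)] e by auto
        moreover have "\<chi> e k = \<chi> k e" "e + k = k + e" using HV[OF h(2)] e by (auto intro: chi_sym add_comm)
        ultimately have "\<chi> (h + e) (k + e) + \<chi> h e = \<chi> h k + \<chi> k e"
          by (metis bit_eq_iff_add add_0)
        then have "\<chi> (h + e) (k + e) = \<chi> h k + \<chi> k e + \<chi> h e"
          by (rule bit_add_move)
        then show ?thesis
          unfolding ee(1)[OF h] t'e[OF h(1)] t'e[OF h(2)] t'H[OF Hadd[OF h]] t[OF h]
          by (simp add: bit_ac)
      qed
      have c0: "\<chi> h k = t' h + t' k + t' (h + k)" if h: "h \<in> H" "k \<in> H" for h k
        using t[OF h] t'H h Hadd[OF h] by simp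
      have c3: "\<chi> (k + e) h = t' (k + e) + t' h + t' ((k + e) + h)" if h: "h \<in> H" "k \<in> H" for h k
      proof -
        have "\<chi> (k + e) h = \<chi> h (k + e)" "(k + e) + h = h + (k + e)"
          using HV[OF h(1)] HV[OF h(2)] e by (auto intro: chi_sym add_comm)
        then show ?thesis using c1[OF h] by (simp add: bit_ac)
      qed
      have "\<forall>v\<in>K. \<forall>w\<in>K. \<chi> v w = t' v + t' w + t' (v + w)"
        using c0 c1 c2 c3 unfolding K_def by blast
      moreover have "\<forall>v\<in>K. \<forall>w\<in>K. v + w \<in> K"
        using Hadd ee unfolding K_def by auto
      moreover have "K \<subseteq> V" "0\<^sub>v m \<in> K"
        using HV e H0 by (auto simp: K_def)
      ultimately have "good K" unfolding good_def by blast
      then have "card K \<le> card H" using H(2) by blast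
      moreover have "H \<subset> K"
        using notin[OF H0] H0 by (auto simp: K_def)
      moreover have "finite K" using \<open>K \<subseteq> V\<close> finite_V finite_subset by blast
      ultimately show False using psubset_card_mono[of K H] by linarith
    qed
  qed
  then show ?thesis using t by blast
qed

end

section \<open>Factor sets as functions with values in the two-element field\<close>

definition factor_bit :: "(bit vec \<Rightarrow> bit vec \<Rightarrow> int) \<Rightarrow> bit vec \<Rightarrow> bit vec \<Rightarrow> bit" where
  "factor_bit \<phi> v w = (if \<phi> v w = 1 then 0 else 1)"

lemma bsign_eq_minus_1_iff [simp]: "bsign a = - 1 \<longleftrightarrow> a = 1"
  by (cases a) auto

lemma bit_0_or_1: "(a :: bit) = 0 \<or> a = 1"
  by (cases a) auto

text \<open>\<open>F\<close> is left arbitrary so that the equivalence works in both directions: it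
  extracts the laws of a given factor set, and it certifies one built from a polynomial.\<close>

lemma factor_set_iff_bit:
  assumes "\<forall>v\<in>V. \<forall>w\<in>V. \<phi> v w = bsign (F v w)" and "even_code m V"
  shows "factor_set m V \<phi> \<longleftrightarrow>
    (\<forall>v\<in>V. F v v = wt_form v) \<and>
    (\<forall>v\<in>V. \<forall>w\<in>V. F v w = wt_form2 v w + F w v) \<and>
    (\<forall>v\<in>V. F (0\<^sub>v m) v = 0 \<and> F v (0\<^sub>v m) = 0) \<and>
    (\<forall>v\<in>V. \<forall>w\<in>V. \<forall>u\<in>V. F (v + w) u = F v (w + u) + F v w + F w u + wt_form3 v w u)"
proof -
  interpret even_code m V by fact
  show ?thesis
    unfolding factor_set_def bsign_of_nat
    by (simp add: assms(1) bit_0_or_1 wt_form_def[symmetric] wt_form2_def[symmetric] wt_form3_def[symmetric]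
        flip: bsign_add)
qed

locale code_loop = even_code +
  fixes \<phi> :: "bit vec \<Rightarrow> bit vec \<Rightarrow> int"
  assumes factor: "factor_set m V \<phi>"
begin

abbreviation "F \<equiv> factor_bit \<phi>"

lemma phi: "v \<in> V \<Longrightarrow> w \<in> V \<Longrightarrow> \<phi> v w = bsign (F v w)"
  using factor[unfolded factor_set_def, THEN conjunct1] by (auto simp: factor_bit_def)

lemma factor_bits:
  "(\<forall>v\<in>V. F v v = wt_form v) \<and>
    (\<forall>v\<in>V. \<forall>w\<in>V. F v w = wt_form2 v w + F w v) \<and>
    (\<forall>v\<in>V. F (0\<^sub>v m) v = 0 \<and> F v (0\<^sub>v m) = 0) \<and>
    (\<forall>v\<in>V. \<forall>w\<in>V. \<forall>u\<in>V. F (v + w) u = F v (w + u) + F v w + F w u + wt_form3 v w u)"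
proof -
  have "\<forall>v\<in>V. \<forall>w\<in>V. \<phi> v w = bsign (F v w)" using phi by blast
  then show ?thesis by (rule factor_set_iff_bit[THEN iffD1, OF _ even_code_axioms factor])
qed

lemmas F_self = factor_bits[THEN conjunct1, rule_format]
lemmas F_swap = factor_bits[THEN conjunct2, THEN conjunct1, rule_format]
lemmas F_zero = factor_bits[THEN conjunct2, THEN conjunct2, THEN conjunct1, rule_format]
lemmas F_assoc = factor_bits[THEN conjunct2, THEN conjunct2, THEN conjunct2, rule_format]

end

section \<open>Isomorphisms of code loops\<close>

context even_code
begin

lemma code_space_vs: "vectorspace class_ring (module_vec TYPE(bit) m\<lparr>carrier := V\<rparr>)"
  using code vectorspace.subspace_is_vs[OF vec_vs]
  unfolding double_even_code_def by blast

lemma card_V: "card V = 2 ^ code_dim m V"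
  using card_bit_space[OF code_space_vs] finite_V by (simp add: code_dim_def)

lemma code_dim_4I:
  assumes "card V = 16"
  shows "code_dim m V = 4"
proof -
  have "2 ^ code_dim m V = (2 :: nat) ^ 4"
    using card_V assms by simp
  then show ?thesis by (simp only: power_inject_exp one_less_numeral_iff semiring_norm)
qed

end

lemma loop_of_code_simps [simp]:
  "carrier (loop_of_code m V \<phi>) = {1, -1} \<times> V"
  "(\<epsilon>, v) \<otimes>\<^bsub>loop_of_code m V \<phi>\<^esub> (\<delta>, w) = (\<epsilon> * \<delta> * \<phi> v w, v + w)"
  "\<one>\<^bsub>loop_of_code m V \<phi>\<^esub> = (1, 0\<^sub>v m)"
  by (auto simp: loop_of_code_def)

lemma bsign_mem_iff: "\<epsilon> \<in> {1, -1} \<longleftrightarrow> (\<exists>g. \<epsilon> = bsign g)"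
  by (metis bsign_mem insert_iff singletonD sign_eq_bsign)

text \<open>The codeword of a quotient is forced to be \<open>v + w\<close>, because
  \<open>V\<close> is an elementary abelian 2-group. Its sign bit then solves a linear equation in
  one unknown, which explains the witnesses.\<close>

lemma (in code_loop) alg_loop_loop_of_code: "alg_loop (loop_of_code m V \<phi>)"
proof -
  have elem: "x \<in> {1, -1} \<times> V \<longleftrightarrow> (\<exists>g. \<exists>v\<in>V. x = (bsign g, v))" for x :: "int \<times> bit vec"
    by (cases x) (auto simp: bsign_mem_iff[simplified])
  have mult: "(bsign g, v) \<otimes>\<^bsub>loop_of_code m V \<phi>\<^esub> (bsign h, w) = (bsign (g + h + F v w), v + w)"
    if "v \<in> V" "w \<in> V" for g h v w
    using that by (simp add: phi bsign_add)
  have sum: "v + w = u \<longleftrightarrow> w = v + u" if "v \<in> V" "w \<in> V" "u \<in> V" for v w u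
    using that by (metis add_self_left)
  have bsum: "g + h + k = l \<longleftrightarrow> h = g + k + l" for g h k l :: bit
    by (cases g; cases h; cases k; cases l) auto
  show ?thesis
  proof (unfold_locales, unfold loop_of_code_simps(1) elem)
    fix x y :: "int \<times> bit vec"
    assume "\<exists>g. \<exists>v\<in>V. x = (bsign g, v)" "\<exists>g. \<exists>v\<in>V. y = (bsign g, v)"
    then obtain g v h w where xy: "x = (bsign g, v)" "y = (bsign h, w)" and [simp]: "v \<in> V" "w \<in> V"
      by blast
    show "\<exists>g. \<exists>v\<in>V. x \<otimes>\<^bsub>loop_of_code m V \<phi>\<^esub> y = (bsign g, v)"
      unfolding xy using mult by (metis \<open>v \<in> V\<close> \<open>w \<in> V\<close> add_closed)
    show "\<exists>!z. (\<exists>g. \<exists>v\<in>V. z = (bsign g, v)) \<and> x \<otimes>\<^bsub>loop_of_code m V \<phi>\<^esub> z = y"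
      unfolding xy
    proof (rule ex1I[of _ "(bsign (g + F v (v + w) + h), v + w)"])
      show "(\<exists>k. \<exists>u\<in>V. (bsign (g + F v (v + w) + h), v + w) = (bsign k, u)) \<and>
        (bsign g, v) \<otimes>\<^bsub>loop_of_code m V \<phi>\<^esub> (bsign (g + F v (v + w) + h), v + w) = (bsign h, w)"
        by (auto simp: mult add_self_left bit_ac simp del: loop_of_code_simps)
    next
      fix z assume "(\<exists>k. \<exists>u\<in>V. z = (bsign k, u)) \<and> (bsign g, v) \<otimes>\<^bsub>loop_of_code m V \<phi>\<^esub> z = (bsign h, w)"
      then obtain k u where z: "z = (bsign k, u)" "u \<in> V"
        "g + k + F v u = h" "v + u = w"
        by (auto simp: mult simp del: loop_of_code_simps)
      then show "z = (bsign (g + F v (v + w) + h), v + w)"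
        by (metis bsum sum \<open>v \<in> V\<close> \<open>w \<in> V\<close>)
    qed
    show "\<exists>!z. (\<exists>g. \<exists>v\<in>V. z = (bsign g, v)) \<and> z \<otimes>\<^bsub>loop_of_code m V \<phi>\<^esub> x = y"
      unfolding xy
    proof (rule ex1I[of _ "(bsign (g + F (v + w) v + h), v + w)"])
      show "(\<exists>k. \<exists>u\<in>V. (bsign (g + F (v + w) v + h), v + w) = (bsign k, u)) \<and>
        (bsign (g + F (v + w) v + h), v + w) \<otimes>\<^bsub>loop_of_code m V \<phi>\<^esub> (bsign g, v) = (bsign h, w)"
        by (auto simp: mult V_ac bit_ac simp del: loop_of_code_simps)
    next
      fix z assume "(\<exists>k. \<exists>u\<in>V. z = (bsign k, u)) \<and> z \<otimes>\<^bsub>loop_of_code m V \<phi>\<^esub> (bsign g, v) = (bsign h, w)"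
      then obtain k u where z: "z = (bsign k, u)" "u \<in> V"
        "k + g + F u v = h" "u + v = w"
        by (auto simp: mult simp del: loop_of_code_simps)
      then have "g + k + F u v = h" "v + u = w"
        using z by (simp_all add: add_comm add.commute)
      then show "z = (bsign (g + F (v + w) v + h), v + w)"
        using z(1,2) by (metis bsum sum \<open>v \<in> V\<close> \<open>w \<in> V\<close>)
    qed
  qed (auto simp: phi F_zero bsign_mem_iff[simplified] intro: exI[of _ 0])
qed

text \<open>Two factor sets on a code with the same weight form differ by a symmetric cocycle vanishing
  on the diagonal, hence by a coboundary.\<close>

lemma loop_of_code_iso:
  assumes "code_loop m V \<phi>" "code_loop m' V' \<phi>'"
    and fr: "even_code.frame m V a b c d" "even_code.frame m' V' a' b' c' d'"
    and card: "card V = 16" "card V' = 16"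
    and eq: "even_code.char_tuple a b c d = even_code.char_tuple a' b' c' d'"
  shows "\<exists>h. h \<in> iso (loop_of_code m V \<phi>) (loop_of_code m' V' \<phi>')"
proof -
  interpret A: code_loop m V \<phi> by fact
  interpret B: code_loop m' V' \<phi>' by fact
  let ?A = "A.comb a b c d" and ?B = "B.comb a' b' c' d'"
  have inV: "a \<in> V" "b \<in> V" "c \<in> V" "d \<in> V" and inV': "a' \<in> V'" "b' \<in> V'" "c' \<in> V'" "d' \<in> V'"
    using fr by (auto simp: A.frame_def B.frame_def)
  have bA: "bij_betw ?A UNIV V" and bB: "bij_betw ?B UNIV V'"
    using A.frame_bij B.frame_bij fr card by auto
  define \<theta> where "\<theta> = ?B \<circ> inv_into UNIV ?A"
  have \<theta>A: "\<theta> (?A x) = ?B x" for x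
    using bA by (simp add: \<theta>_def bij_betw_def)
  have coord: "\<exists>x. v = ?A x" if "v \<in> V" for v
    using bA that by (auto simp: bij_betw_def)
  have b\<theta>: "bij_betw \<theta> V V'"
    unfolding \<theta>_def by (rule bij_betw_trans[OF bij_betw_inv_into[OF bA] bB])
  have \<theta>V: "\<theta> v \<in> V'" if "v \<in> V" for v
    using b\<theta> that by (auto simp: bij_betw_def)
  have \<theta>add: "\<theta> (v + w) = \<theta> v + \<theta> w" if v: "v \<in> V" and w: "w \<in> V" for v w
  proof -
    obtain x y where xy: "v = ?A x" "w = ?A y" using coord[OF v] coord[OF w] by blast
    show ?thesis
      unfolding xy \<theta>A A.comb_add[OF inV] B.comb_add[OF inV'] ..
  qed
  have \<theta>0: "\<theta> (0\<^sub>v m) = 0\<^sub>v m'"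
    using \<theta>add[of "0\<^sub>v m" "0\<^sub>v m"] \<theta>V[of "0\<^sub>v m"] by simp
  have form: "wt_form (\<theta> v) = wt_form v" if v: "v \<in> V" for v
  proof -
    obtain x where x: "v = ?A x" using coord[OF v] by blast
    show ?thesis
      unfolding x \<theta>A A.form_comb[OF fr(1)] B.form_comb[OF fr(2)] eq ..
  qed
  \<comment> \<open>\<open>\<theta>\<close> respects sums and \<open>wt_form\<close>, hence also the
    polarisation, and by the same argument the trilinear form.\<close>
  have form2: "wt_form2 (\<theta> v) (\<theta> w) = wt_form2 v w" if "v \<in> V" "w \<in> V" for v w
    using form[of "v + w"] form[of v] form[of w] that \<theta>add[of v w] \<theta>V
    by (simp add: A.form_add B.form_add)
  have form3: "wt_form3 (\<theta> u) (\<theta> v) (\<theta> w) = wt_form3 u v w" if "u \<in> V" "v \<in> V" "w \<in> V" for u v w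
    using form2[of "u + v" w] form2[of u w] form2[of v w] that \<theta>add[of u v] \<theta>V
    by (simp add: A.form2_add_left B.form2_add_left)
  \<comment> \<open>The quotient of the two factor sets, written additively. The weight forms on
    both sides agree and cancel, which leaves exactly the hypotheses of
    \<open>A.coboundary\<close>.\<close>
  define \<chi> where "\<chi> v w = A.F v w + B.F (\<theta> v) (\<theta> w)" for v w
  have "\<exists>t. \<forall>v\<in>V. \<forall>w\<in>V. \<chi> v w = t v + t w + t (v + w)"
  proof (rule A.coboundary)
    fix v w assume vw: "v \<in> V" "w \<in> V"
    show "\<chi> v v = 0" using vw by (simp add: \<chi>_def A.F_self B.F_self \<theta>V form bit_add_self)
    show "\<chi> (0\<^sub>v m) v = 0" using vw by (simp add: \<chi>_def A.F_zero B.F_zero \<theta>V \<theta>0)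
    show "\<chi> v w = \<chi> w v"
      using A.F_swap[OF vw] B.F_swap[OF \<theta>V \<theta>V, OF vw] form2[OF vw] by (simp add: \<chi>_def bit_ac)
    fix u assume u: "u \<in> V"
    have "\<chi> (u + v) w = \<chi> u (v + w) + \<chi> u v + \<chi> v w"
      using A.F_assoc[OF u vw] B.F_assoc[OF \<theta>V \<theta>V \<theta>V, OF u vw] form3[OF u vw] u vw
      by (simp add: \<chi>_def \<theta>add bit_ac)
    then show "\<chi> (u + v) w + \<chi> u v = \<chi> u (v + w) + \<chi> v w"
      by (simp add: bit_ac)
  qed
  then obtain t where t: "\<And>v w. v \<in> V \<Longrightarrow> w \<in> V \<Longrightarrow> \<chi> v w = t v + t w + t (v + w)" by blast
  \<comment> \<open>Rescaling the sign over \<open>v\<close> by \<open>t v\<close> absorbs the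
    coboundary.\<close>
  define h where "h = (\<lambda>(\<epsilon>, v). (\<epsilon> * bsign (t v), \<theta> v))"
  have "h \<in> hom (loop_of_code m V \<phi>) (loop_of_code m' V' \<phi>')"
  proof (rule homI)
    fix x assume "x \<in> carrier (loop_of_code m V \<phi>)"
    then show "h x \<in> carrier (loop_of_code m' V' \<phi>')"
      using \<theta>V by (auto simp: h_def)
  next
    fix x y assume "x \<in> carrier (loop_of_code m V \<phi>)" "y \<in> carrier (loop_of_code m V \<phi>)"
    then obtain \<epsilon> v \<delta> w where xy: "x = (\<epsilon>, v)" "y = (\<delta>, w)" "v \<in> V" "w \<in> V" by auto
    have "A.F v w + t (v + w) = t v + t w + B.F (\<theta> v) (\<theta> w)"
      using t[OF xy(3,4)] unfolding \<chi>_def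
      by (metis add.assoc add.commute bit_add_self_left)
    then have "bsign (A.F v w) * bsign (t (v + w)) = bsign (t v) * bsign (t w) * bsign (B.F (\<theta> v) (\<theta> w))"
      by (metis bsign_add)
    then show "h (x \<otimes>\<^bsub>loop_of_code m V \<phi>\<^esub> y) = h x \<otimes>\<^bsub>loop_of_code m' V' \<phi>'\<^esub> h y"
      using xy \<theta>V by (simp add: h_def A.phi B.phi \<theta>add algebra_simps)
  qed
  moreover have "bij_betw h (carrier (loop_of_code m V \<phi>)) (carrier (loop_of_code m' V' \<phi>'))"
  proof (rule bij_betw_byWitness[where f' = "\<lambda>(\<epsilon>, w). (\<epsilon> * bsign (t (inv_into V \<theta> w)), inv_into V \<theta> w)"])
    have sq: "\<epsilon> * bsign g * bsign g = \<epsilon>" for \<epsilon> g by (cases g) auto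
    have 1: "inv_into V \<theta> (\<theta> v) = v" if "v \<in> V" for v
      using b\<theta> that by (simp add: bij_betw_inv_into_left)
    have 2: "\<theta> (inv_into V \<theta> w) = w" "inv_into V \<theta> w \<in> V" if "w \<in> V'" for w
      using b\<theta> that by (simp_all add: bij_betw_inv_into_right bij_betw_def inv_into_into)
    show "\<forall>x\<in>carrier (loop_of_code m V \<phi>). (case h x of (\<epsilon>, w) \<Rightarrow>
        (\<epsilon> * bsign (t (inv_into V \<theta> w)), inv_into V \<theta> w)) = x"
      using 1 sq by (auto simp: h_def)
    show "\<forall>x\<in>carrier (loop_of_code m' V' \<phi>'). h (case x of (\<epsilon>, w) \<Rightarrow>
        (\<epsilon> * bsign (t (inv_into V \<theta> w)), inv_into V \<theta> w)) = x"
      using 2 sq by (auto simp: h_def)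
    have pm: "\<epsilon> * bsign g = 1 \<or> \<epsilon> * bsign g = - 1" if "\<epsilon> = 1 \<or> \<epsilon> = - 1" for \<epsilon> g
      using that by (cases g) auto
    show "h ` carrier (loop_of_code m V \<phi>) \<subseteq> carrier (loop_of_code m' V' \<phi>')"
      using \<theta>V pm by (fastforce simp: h_def)
    show "(\<lambda>(\<epsilon>, w). (\<epsilon> * bsign (t (inv_into V \<theta> w)), inv_into V \<theta> w)) ` carrier (loop_of_code m' V' \<phi>')
        \<subseteq> carrier (loop_of_code m V \<phi>)"
      using 2 pm by (fastforce)
  qed
  ultimately show ?thesis by (auto simp: iso_def)
qed

section \<open>Characteristic vectors of abstract code loops\<close>

fun vec10 :: "bit10 \<Rightarrow> bit vec" where
  "vec10 (l1, l2, l3, l4, l5, l6, l7, l8, l9, l10) = vec_of_list [l1, l2, l3, l4, l5, l6, l7, l8, l9, l10]"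

lemma inj_vec10: "inj vec10"
proof (rule injI)
  fix x y assume "vec10 x = vec10 y"
  then have "list_of_vec (vec10 x) = list_of_vec (vec10 y)" by (rule arg_cong)
  then show "x = y"
    by (cases x rule: vec10.cases; cases y rule: vec10.cases) (simp add: list_vec)
qed

lemma eq_vec10_iff:
  "l = vec10 (l1, l2, l3, l4, l5, l6, l7, l8, l9, l10) \<longleftrightarrow> l \<in> carrier_vec 10 \<and>
    l $ 0 = l1 \<and> l $ 1 = l2 \<and> l $ 2 = l3 \<and> l $ 3 = l4 \<and> l $ 4 = l5 \<and> l $ 5 = l6 \<and>
    l $ 6 = l7 \<and> l $ 7 = l8 \<and> l $ 8 = l9 \<and> l $ 9 = l10" (is "?L \<longleftrightarrow> ?R")
proof
  assume ?L
  then have l: "l = vec_of_list [l1, l2, l3, l4, l5, l6, l7, l8, l9, l10]" by (simp only: vec10.simps)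
  have dim: "dim_vec l = 10" unfolding l dim_vec_of_list by simp
  have nth: "l $ i = [l1, l2, l3, l4, l5, l6, l7, l8, l9, l10] ! i" for i
    unfolding l vec_of_list_index ..
  show ?R using dim unfolding nth carrier_vec_def by simp
next
  assume R: ?R
  show ?L unfolding vec10.simps
  proof (rule eq_vecI)
    show dim: "dim_vec l = dim_vec (vec_of_list [l1, l2, l3, l4, l5, l6, l7, l8, l9, l10])"
      using R by (simp add: carrier_vecD[of l 10] dim_vec_of_list del: vec_of_list_Cons)
    fix i assume "i < dim_vec (vec_of_list [l1, l2, l3, l4, l5, l6, l7, l8, l9, l10])"
    then have "i < 10" using R unfolding dim[symmetric] by (simp add: carrier_vecD[of l 10])
    then have "i = 0 \<or> i = 1 \<or> i = 2 \<or> i = 3 \<or> i = 4 \<or> i = 5 \<or> i = 6 \<or> i = 7 \<or> i = 8 \<or> i = 9"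
      by presburger
    then show "l $ i = vec_of_list [l1, l2, l3, l4, l5, l6, l7, l8, l9, l10] $ i"
      unfolding vec_of_list_index using R by (elim disjE) simp_all
  qed
qed

text \<open>The coding \<open>f\<close> is a parameter, so one loop can be viewed through two
  codings at once; the uniqueness of \<open>minus_one\<close> is proved in this way.\<close>

locale coded_loop = code_loop m V \<phi> for m V \<phi> +
  fixes L :: "'a monoid" and f :: "'a \<Rightarrow> int \<times> bit vec"
  assumes loop: "alg_loop L" and f: "f \<in> iso L (loop_of_code m V \<phi>)"
begin

definition word :: "'a \<Rightarrow> bit vec" where
  "word x = snd (f x)"

definition sbit :: "'a \<Rightarrow> bit" where
  "sbit x = (if fst (f x) = 1 then 0 else 1)"

abbreviation mul :: "'a \<Rightarrow> 'a \<Rightarrow> 'a" (infixl \<open>\<cdot>\<close> 70) where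
  "x \<cdot> y \<equiv> x \<otimes>\<^bsub>L\<^esub> y"

lemma f_bij: "bij_betw f (carrier L) ({1, -1} \<times> V)"
  using f by (auto simp: iso_def)

lemma f_eq: "x \<in> carrier L \<Longrightarrow> f x = (bsign (sbit x), word x)"
  using bij_betw_apply[OF f_bij, of x] by (cases "f x") (auto simp: sbit_def word_def)

lemma word_closed [simp]: "x \<in> carrier L \<Longrightarrow> word x \<in> V"
  using bij_betw_apply[OF f_bij, of x] by (cases "f x") (auto simp: word_def)

lemma eqI: "x \<in> carrier L \<Longrightarrow> y \<in> carrier L \<Longrightarrow> sbit x = sbit y \<Longrightarrow> word x = word y \<Longrightarrow> x = y"
  using f_bij f_eq by (metis bij_betw_imp_inj_on inj_onD)

lemma obtain_elem:
  assumes "v \<in> V"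
  obtains x where "x \<in> carrier L" "sbit x = g" "word x = v"
proof -
  have "(bsign g, v) \<in> {1, -1} \<times> V" using assms by (auto simp: bsign_mem_iff)
  then obtain x where x: "x \<in> carrier L" "f x = (bsign g, v)"
    using f_bij unfolding bij_betw_def by (metis imageE)
  then show ?thesis using that[of x] f_eq[of x] by simp
qed

lemma mult_closed [simp]: "x \<in> carrier L \<Longrightarrow> y \<in> carrier L \<Longrightarrow> x \<cdot> y \<in> carrier L"
  using loop by (rule alg_loop.m_closed)

lemma one_closed [simp]: "\<one>\<^bsub>L\<^esub> \<in> carrier L"
  using loop by (rule alg_loop.one_closed)

lemma
  assumes "x \<in> carrier L" "y \<in> carrier L"
  shows word_mult [simp]: "word (x \<cdot> y) = word x + word y"
    and sbit_mult [simp]: "sbit (x \<cdot> y) = sbit x + sbit y + F (word x) (word y)"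
proof -
  have "f (x \<cdot> y) = f x \<otimes>\<^bsub>loop_of_code m V \<phi>\<^esub> f y"
    using f assms by (auto simp: iso_def hom_def)
  then have "(bsign (sbit (x \<cdot> y)), word (x \<cdot> y)) = (bsign (sbit x + sbit y + F (word x) (word y)), word x + word y)"
    using assms by (simp add: f_eq phi bsign_add)
  then show "word (x \<cdot> y) = word x + word y" "sbit (x \<cdot> y) = sbit x + sbit y + F (word x) (word y)"
    by auto
qed

lemma one_simps [simp]: "word \<one>\<^bsub>L\<^esub> = 0\<^sub>v m" "sbit \<one>\<^bsub>L\<^esub> = 0"
proof -
  have 1: "\<one>\<^bsub>L\<^esub> \<cdot> \<one>\<^bsub>L\<^esub> = \<one>\<^bsub>L\<^esub>"
    using loop one_closed by (rule alg_loop.l_one)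
  have "word \<one>\<^bsub>L\<^esub> + word \<one>\<^bsub>L\<^esub> = word \<one>\<^bsub>L\<^esub>"
    using word_mult[OF one_closed one_closed] unfolding 1 by simp
  then show w: "word \<one>\<^bsub>L\<^esub> = 0\<^sub>v m"
    using word_closed[OF one_closed] by simp
  have "sbit \<one>\<^bsub>L\<^esub> = sbit \<one>\<^bsub>L\<^esub> + sbit \<one>\<^bsub>L\<^esub> + F (word \<one>\<^bsub>L\<^esub>) (word \<one>\<^bsub>L\<^esub>)"
    using sbit_mult[OF one_closed one_closed] unfolding 1 .
  then show "sbit \<one>\<^bsub>L\<^esub> = 0"
    by (simp add: w F_zero bit_add_self)
qed

text \<open>The square of \<open>x\<close> is the sign with exponent
  \<open>wt_form (word x)\<close>, so the inverse is \<open>x\<close> times that sign. Since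
  \<open>m_inv\<close> is a definite description and associativity is absent, uniqueness is taken
  from left division.\<close>

lemma
  assumes x: "x \<in> carrier L"
  shows inv_closed [simp]: "inv\<^bsub>L\<^esub> x \<in> carrier L"
    and word_inv [simp]: "word (inv\<^bsub>L\<^esub> x) = word x"
    and sbit_inv [simp]: "sbit (inv\<^bsub>L\<^esub> x) = sbit x + wt_form (word x)"
proof -
  obtain y where y: "y \<in> carrier L" "sbit y = sbit x + wt_form (word x)" "word y = word x"
    using obtain_elem word_closed[OF x] by metis
  have xy: "x \<cdot> y = \<one>\<^bsub>L\<^esub>" "y \<cdot> x = \<one>\<^bsub>L\<^esub>"
    using x y by (auto intro!: eqI simp: F_self bit_ac)
  have uniq: "z = y" if "z \<in> carrier L" "x \<cdot> z = \<one>\<^bsub>L\<^esub>" for z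
    using alg_loop.l_div[OF loop x one_closed] that y(1) xy(1) by blast
  have "inv\<^bsub>L\<^esub> x = y"
    unfolding m_inv_def
  proof (rule the_equality)
    show "y \<in> carrier L \<and> x \<cdot> y = \<one>\<^bsub>L\<^esub> \<and> y \<cdot> x = \<one>\<^bsub>L\<^esub>"
      using y(1) xy by blast
  qed (use uniq in blast)
  then show "inv\<^bsub>L\<^esub> x \<in> carrier L" "word (inv\<^bsub>L\<^esub> x) = word x" "sbit (inv\<^bsub>L\<^esub> x) = sbit x + wt_form (word x)"
    using y by auto
qed

lemma loop_comm_closed [simp]: "x \<in> carrier L \<Longrightarrow> y \<in> carrier L \<Longrightarrow> loop_comm L x y \<in> carrier L"
  by (simp add: loop_comm_def)

text \<open>Both factors of the commutator lie over the same codeword, so their product contributes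
  \<open>wt_form\<close> of the sum; the two inverses contribute \<open>wt_form\<close> of each
  element. All other bits cancel in pairs, and the polarisation remains.\<close>

lemma loop_comm_simps [simp]:
  assumes "x \<in> carrier L" "y \<in> carrier L"
  shows "word (loop_comm L x y) = 0\<^sub>v m" "sbit (loop_comm L x y) = wt_form2 (word x) (word y)"
  using assms by (simp_all add: loop_comm_def F_self form_add bit_ac)

lemma loop_assoc_closed [simp]: "x \<in> carrier L \<Longrightarrow> y \<in> carrier L \<Longrightarrow> z \<in> carrier L \<Longrightarrow> loop_assoc L x y z \<in> carrier L"
  by (simp add: loop_assoc_def)

lemma loop_assoc_simps [simp]:
  assumes "x \<in> carrier L" "y \<in> carrier L" "z \<in> carrier L"
  shows "word (loop_assoc L x y z) = 0\<^sub>v m"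
    "sbit (loop_assoc L x y z) = wt_form3 (word x) (word y) (word z)"
  using assms
  by (simp_all add: loop_assoc_def add_assoc F_self F_assoc[of "word x" "word y" "word z"] bit_ac)

lemma assoc_iff:
  assumes "x \<in> carrier L" "y \<in> carrier L" "z \<in> carrier L"
  shows "(x \<cdot> y) \<cdot> z = x \<cdot> (y \<cdot> z) \<longleftrightarrow> wt_form3 (word x) (word y) (word z) = 0"
proof -
  have "word ((x \<cdot> y) \<cdot> z) = word (x \<cdot> (y \<cdot> z))"
    using assms by (simp add: add_assoc)
  then have "(x \<cdot> y) \<cdot> z = x \<cdot> (y \<cdot> z) \<longleftrightarrow> sbit ((x \<cdot> y) \<cdot> z) = sbit (x \<cdot> (y \<cdot> z))"
    using assms by (metis eqI mult_closed)
  also have "\<dots> \<longleftrightarrow> sbit ((x \<cdot> y) \<cdot> z) + sbit (x \<cdot> (y \<cdot> z)) = 0"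
    by (rule bit_eq_iff_add)
  also have "\<dots> \<longleftrightarrow> wt_form3 (word x) (word y) (word z) = 0"
    using assms by (simp add: F_assoc bit_ac)
  finally show ?thesis .
qed

end

locale nonassoc_coded_loop = coded_loop m V \<phi> L f for m V \<phi> and L :: "'a monoid" and f +
  assumes nonassoc: "nonassociative L"
begin

lemma obtain_nonassoc:
  obtains x y z where "x \<in> carrier L" "y \<in> carrier L" "z \<in> carrier L"
    "wt_form3 (word x) (word y) (word z) = 1"
proof -
  obtain x y z where xyz: "x \<in> carrier L" "y \<in> carrier L" "z \<in> carrier L"
    and "(x \<cdot> y) \<cdot> z \<noteq> x \<cdot> (y \<cdot> z)"
    using nonassoc unfolding nonassociative_def by blast
  then have "wt_form3 (word x) (word y) (word z) = 1"
    using assoc_iff[OF xyz] by simp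
  then show ?thesis using that xyz by blast
qed

text \<open>A triple that fails to associate does so regardless of the coding. Its associator
  therefore has codeword zero and sign bit 1 in every coding, which makes the defining description
  unique.\<close>

lemma minus_one:
  shows minus_one_closed [simp]: "minus_one L \<in> carrier L"
    and word_minus_one [simp]: "word (minus_one L) = 0\<^sub>v m"
    and sbit_minus_one [simp]: "sbit (minus_one L) = 1"
proof -
  obtain x y z where xyz: "x \<in> carrier L" "y \<in> carrier L" "z \<in> carrier L"
    and T: "wt_form3 (word x) (word y) (word z) = 1" by (rule obtain_nonassoc)
  define u where "u = loop_assoc L x y z"
  have u: "u \<in> carrier L" "word u = 0\<^sub>v m" "sbit u = 1"
    using xyz T by (simp_all add: u_def)
  have na: "(x \<cdot> y) \<cdot> z \<noteq> x \<cdot> (y \<cdot> z)" using assoc_iff[OF xyz] T by simp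
  have "minus_one L = u"
    unfolding minus_one_def
  proof (rule the_equality)
    show "\<exists>m V \<phi> f. double_even_code m V \<and> factor_set m V \<phi> \<and> f \<in> iso L (loop_of_code m V \<phi>) \<and>
        u \<in> carrier L \<and> f u = (- 1, 0\<^sub>v m)"
      using code factor f u f_eq[OF u(1)] by (auto intro!: exI[of _ m] exI[of _ V] exI[of _ \<phi>] exI[of _ f])
  next
    fix w
    assume "\<exists>m V \<phi> f. double_even_code m V \<and> factor_set m V \<phi> \<and> f \<in> iso L (loop_of_code m V \<phi>) \<and>
        w \<in> carrier L \<and> f w = (- 1, 0\<^sub>v m)"
    then obtain m' V' \<phi>' f' where *: "double_even_code m' V'" "factor_set m' V' \<phi>'"
      "f' \<in> iso L (loop_of_code m' V' \<phi>')" "w \<in> carrier L" "f' w = (- 1, 0\<^sub>v m')" by blast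
    interpret C: coded_loop m' V' \<phi>' L f'
      by (intro coded_loop.intro code_loop.intro even_code.intro code_loop_axioms.intro
          coded_loop_axioms.intro * loop)
    have "wt_form3 (C.word x) (C.word y) (C.word z) = 1"
      using na C.assoc_iff[OF xyz] by (metis bit_not_zero_iff)
    then have "C.word u = 0\<^sub>v m'" "C.sbit u = 1"
      using xyz by (simp_all add: u_def)
    moreover have "C.word w = 0\<^sub>v m'" "C.sbit w = 1"
      using *(5) by (simp_all add: C.word_def C.sbit_def)
    ultimately show "w = u" using C.eqI *(4) u(1) by metis
  qed
  then show "minus_one L \<in> carrier L" "word (minus_one L) = 0\<^sub>v m" "sbit (minus_one L) = 1"
    using u by auto
qed

lemma sign_pow_simps [simp]:
  "sign_pow L e \<in> carrier L" "word (sign_pow L e) = 0\<^sub>v m" "sbit (sign_pow L e) = e"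
  by (auto simp: sign_pow_def)

lemma eq_sign_pow_iff: "x \<in> carrier L \<Longrightarrow> word x = 0\<^sub>v m \<Longrightarrow> x = sign_pow L e \<longleftrightarrow> e = sbit x"
  by (metis eqI sign_pow_simps)

text \<open>The cosets of the central pair, by \<open>pm_coset\<close>. Indexing them by codewords
  identifies the quotient space with \<open>V\<close>.\<close>

definition fibre :: "bit vec \<Rightarrow> 'a set" where
  "fibre v = {x \<in> carrier L. word x = v}"

lemma inj_fibre: "inj_on fibre V"
proof (rule inj_onI)
  fix v w assume "v \<in> V" "w \<in> V" "fibre v = fibre w"
  moreover obtain x where "x \<in> carrier L" "word x = v" using obtain_elem[OF \<open>v \<in> V\<close>] by metis
  ultimately show "v = w" unfolding fibre_def by blast
qed

lemma pm_coset:
  assumes x: "x \<in> carrier L"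
  shows "pm_one L #>\<^bsub>L\<^esub> x = fibre (word x)"
proof -
  have "y = \<one>\<^bsub>L\<^esub> \<cdot> x \<or> y = minus_one L \<cdot> x" if y: "y \<in> carrier L" "word y = word x" for y
  proof (cases "sbit y = sbit x")
    case True
    then show ?thesis using x y by (intro disjI1 eqI) (auto simp: F_zero)
  next
    case False
    then have "sbit y = 1 + sbit x" by (cases "sbit x"; cases "sbit y") auto
    then show ?thesis using x y by (intro disjI2 eqI) (auto simp: F_zero)
  qed
  then show ?thesis
    using x by (auto simp: r_coset_def fibre_def)
qed

lemma fibre_image: "word ` carrier L = V"
  using obtain_elem word_closed by (metis image_eqI image_subsetI subsetI subset_antisym)

lemma obtain_word: "v \<in> V \<Longrightarrow> \<exists>x. x \<in> carrier L \<and> word x = v"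
  using obtain_elem by metis

lemma quotient_simps:
  "carrier (quotient_space L) = fibre ` V"
  "\<zero>\<^bsub>quotient_space L\<^esub> = fibre (0\<^sub>v m)"
  "v \<in> V \<Longrightarrow> w \<in> V \<Longrightarrow> fibre v \<oplus>\<^bsub>quotient_space L\<^esub> fibre w = fibre (v + w)"
  "v \<in> V \<Longrightarrow> k \<odot>\<^bsub>quotient_space L\<^esub> fibre v = fibre (k \<cdot>\<^sub>v v)"
proof -
  have "carrier (quotient_space L) = (\<lambda>x. fibre (word x)) ` carrier L"
    using pm_coset by (auto simp: quotient_space_def FactGroup_def RCOSETS_def)
  also have "\<dots> = fibre ` V" by (simp flip: fibre_image add: image_image)
  finally show "carrier (quotient_space L) = fibre ` V" .
  have pm: "pm_one L = fibre (0\<^sub>v m)"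
  proof
    show "pm_one L \<subseteq> fibre (0\<^sub>v m)" by (auto simp: fibre_def)
    show "fibre (0\<^sub>v m) \<subseteq> pm_one L"
    proof
      fix x assume "x \<in> fibre (0\<^sub>v m)"
      then have "x = sign_pow L (sbit x)" using eq_sign_pow_iff by (auto simp: fibre_def)
      then show "x \<in> pm_one L" unfolding sign_pow_def by (metis insertCI)
    qed
  qed
  then show zero: "\<zero>\<^bsub>quotient_space L\<^esub> = fibre (0\<^sub>v m)"
    by (simp add: quotient_space_def FactGroup_def)
  show "fibre v \<oplus>\<^bsub>quotient_space L\<^esub> fibre w = fibre (v + w)" if v: "v \<in> V" and w: "w \<in> V"
  proof -
    have "fibre v <#>\<^bsub>L\<^esub> fibre w = fibre (v + w)"
    proof
      show "fibre v <#>\<^bsub>L\<^esub> fibre w \<subseteq> fibre (v + w)"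
        using v w by (auto simp: set_mult_def fibre_def)
      show "fibre (v + w) \<subseteq> fibre v <#>\<^bsub>L\<^esub> fibre w"
      proof
        fix z assume z: "z \<in> fibre (v + w)"
        obtain x where x: "x \<in> carrier L" "word x = v" "sbit x = 0"
          using obtain_elem[OF v] by metis
        \<comment> \<open>The sign of \<open>y\<close> is free and absorbs the sign of
          \<open>z\<close> together with the factor set.\<close>
        obtain y where y: "y \<in> carrier L" "word y = w" "sbit y = sbit z + F v w"
          using obtain_elem[OF w] by metis
        have "z = x \<cdot> y"
          using x y z by (intro eqI) (auto simp: fibre_def bit_ac)
        then show "z \<in> fibre v <#>\<^bsub>L\<^esub> fibre w"
          using x y by (auto simp: set_mult_def fibre_def)
      qed
    qed
    then show ?thesis by (simp add: quotient_space_def FactGroup_def)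
  qed
  show "k \<odot>\<^bsub>quotient_space L\<^esub> fibre v = fibre (k \<cdot>\<^sub>v v)" if "v \<in> V"
    using that zero by (cases k) (simp_all add: quotient_space_def)
qed

lemma quotient_space_vs: "vectorspace class_ring (quotient_space L)"
proof -
  have "abelian_group (quotient_space L)"
  proof (rule abelian_groupI, unfold quotient_simps(1))
    fix x y assume "x \<in> fibre ` V" "y \<in> fibre ` V"
    then show "x \<oplus>\<^bsub>quotient_space L\<^esub> y \<in> fibre ` V" "x \<oplus>\<^bsub>quotient_space L\<^esub> y = y \<oplus>\<^bsub>quotient_space L\<^esub> x"
      by (auto simp: quotient_simps add_comm)
  qed (auto simp: quotient_simps add_assoc intro!: bexI)
  then have "module class_ring (quotient_space L)"
    by (intro moduleI class_cring.is_cring)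
      (auto simp: quotient_simps add_smult_distrib_vec smult_add_distrib_vec[OF carrier carrier] smult_smult_assoc)
  then show ?thesis
    by (intro vectorspace.intro class_field)
qed

lemma comb4_quotient:
  assumes "a \<in> V" "b \<in> V" "c \<in> V" "d \<in> V"
  shows "comb4 (quotient_space L) (fibre a) (fibre b) (fibre c) (fibre d) = fibre \<circ> comb a b c d"
  using assms by (auto simp: comb4_def comb_def quotient_simps)

text \<open>Through \<open>fibre\<close> the basis condition becomes bijectivity of
  \<open>comb\<close>. A frame yields it by counting; conversely, bijectivity excludes
  \<open>word d = 0\<^sub>v m\<close>, the only part of \<open>frame\<close> not visible in the
  generators.\<close>

lemma generators4_iff:
  assumes card: "card V = 16"
  shows "generators4 L (a, b, c, d) \<longleftrightarrow> {a, b, c, d} \<subseteq> carrier L \<and> frame (word a) (word b) (word c) (word d)"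
proof (cases "{a, b, c, d} \<subseteq> carrier L")
  case True
  then have abcd [simp]: "a \<in> carrier L" "b \<in> carrier L" "c \<in> carrier L" "d \<in> carrier L" by auto
  let ?A = "fibre (word a)" and ?B = "fibre (word b)" and ?C = "fibre (word c)" and ?D = "fibre (word d)"
  let ?comb = "comb (word a) (word b) (word c) (word d)"
  have cosets: "map (\<lambda>x. pm_one L #>\<^bsub>L\<^esub> x) [a, b, c, d] = [?A, ?B, ?C, ?D]"
    by (simp add: pm_coset)
  have basis: "vectorspace.basis class_ring (quotient_space L) {?A, ?B, ?C, ?D} \<longleftrightarrow> bij_betw ?comb UNIV V"
    if "distinct [?A, ?B, ?C, ?D]"
  proof -
    have "bij_betw fibre V (carrier (quotient_space L))"
      using inj_fibre by (simp add: bij_betw_def quotient_simps)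
    moreover have "range ?comb \<subseteq> V" using comb_closed by auto
    ultimately have "bij_betw ?comb UNIV V \<longleftrightarrow> bij_betw (fibre \<circ> ?comb) UNIV (carrier (quotient_space L))"
      by (rule bij_betw_comp_iff2)
    moreover have "{?A, ?B, ?C, ?D} \<subseteq> carrier (quotient_space L)"
      by (simp add: quotient_simps)
    ultimately show ?thesis
      using basis4_iff[OF quotient_space_vs that] by (simp add: comb4_quotient)
  qed
  have dist: "distinct [?A, ?B, ?C, ?D]" if "inj ?comb"
  proof -
    have units: "?comb (1, 0, 0, 0) = word a" "?comb (0, 1, 0, 0) = word b"
      "?comb (0, 0, 1, 0) = word c" "?comb (0, 0, 0, 1) = word d"
      by (simp_all add: comb_def)
    have "distinct (map ?comb [(1, 0, 0, 0), (0, 1, 0, 0), (0, 0, 1, 0), (0, 0, 0, 1)])"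
      by (simp add: inj_eq[OF that])
    then have "distinct [word a, word b, word c, word d]"
      unfolding list.map units .
    then have "distinct (map fibre [word a, word b, word c, word d])"
      by (simp add: inj_on_eq_iff[OF inj_fibre])
    then show ?thesis unfolding list.map .
  qed
  have nz: "word d \<noteq> 0\<^sub>v m" if "inj ?comb"
  proof
    assume "word d = 0\<^sub>v m"
    then have "?comb (0, 0, 0, 1) = ?comb (0, 0, 0, 0)" by (simp add: comb_def)
    then show False using that by (simp add: inj_eq)
  qed
  have a1: "loop_assoc L a b c = minus_one L \<longleftrightarrow> wt_form3 (word a) (word b) (word c) = 1"
    using eq_sign_pow_iff[of "loop_assoc L a b c" 1] by (auto simp: sign_pow_def)
  have "loop_assoc L d x y = \<one>\<^bsub>L\<^esub> \<longleftrightarrow> wt_form3 (word d) (word x) (word y) = 0"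
    if "x \<in> carrier L" "y \<in> carrier L" for x y
    using eq_sign_pow_iff[of "loop_assoc L d x y" 0] that by (auto simp: sign_pow_def)
  then have a2: "(\<forall>x\<in>carrier L. \<forall>y\<in>carrier L. loop_assoc L d x y = \<one>\<^bsub>L\<^esub>) \<longleftrightarrow>
      (\<forall>v\<in>V. \<forall>w\<in>V. wt_form3 (word d) v w = 0)"
    using word_closed obtain_elem by metis
  have gen: "generators4 L (a, b, c, d) \<longleftrightarrow> distinct [?A, ?B, ?C, ?D] \<and>
      vectorspace.basis class_ring (quotient_space L) {?A, ?B, ?C, ?D} \<and>
      wt_form3 (word a) (word b) (word c) = 1 \<and> (\<forall>v\<in>V. \<forall>w\<in>V. wt_form3 (word d) v w = 0)"
    unfolding generators4_def prod.case cosets a1 a2 using True by simp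
  have "frame (word a) (word b) (word c) (word d) \<Longrightarrow> bij_betw ?comb UNIV V"
    using frame_bij card by blast
  then show ?thesis
    using True basis dist nz unfolding gen frame_def by (auto simp: bij_betw_def)
qed (auto simp: generators4_def)

lemma is_char_vector_iff:
  assumes "{a, b, c, d} \<subseteq> carrier L"
  shows "is_char_vector L (a, b, c, d) l \<longleftrightarrow> l = vec10 (char_tuple (word a) (word b) (word c) (word d))"
proof -
  have "a \<in> carrier L" "b \<in> carrier L" "c \<in> carrier L" "d \<in> carrier L" using assms by auto
  then show ?thesis
    unfolding is_char_vector_def char_tuple_def eq_vec10_iff
    by (simp add: eq_sign_pow_iff F_self bit_add_self)
qed

lemma char_orbit_eq:
  assumes "card V = 16"
  shows "char_orbit L = vec10 ` char_tuples"
proof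
  show "char_orbit L \<subseteq> vec10 ` char_tuples"
  proof
    fix l assume "l \<in> char_orbit L"
    then obtain X where X: "generators4 L X" "is_char_vector L X l"
      unfolding char_orbit_def by (elim CollectE exE conjE)
    obtain a b c d where abcd: "X = (a, b, c, d)" by (rule prod_cases4)
    note gen = X(1)[unfolded abcd] and cv = X(2)[unfolded abcd]
    note gen = gen[unfolded generators4_iff[OF assms]]
    note fr = gen[THEN conjunct2]
    note l = cv[unfolded is_char_vector_iff[OF gen[THEN conjunct1]]]
    show "l \<in> vec10 ` char_tuples"
      unfolding l char_tuples_def using fr by blast
  qed
  show "vec10 ` char_tuples \<subseteq> char_orbit L"
  proof
    fix l assume "l \<in> vec10 ` char_tuples"
    then obtain a b c d where fr: "frame a b c d" and l: "l = vec10 (char_tuple a b c d)"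
      by (auto simp: char_tuples_def)
    then have "a \<in> V" "b \<in> V" "c \<in> V" "d \<in> V" by (auto simp: frame_def)
    then obtain a' b' c' d' where "a' \<in> carrier L \<and> word a' = a" "b' \<in> carrier L \<and> word b' = b"
      "c' \<in> carrier L \<and> word c' = c" "d' \<in> carrier L \<and> word d' = d"
      using obtain_word[of a] obtain_word[of b] obtain_word[of c] obtain_word[of d] by blast
    then have sub: "{a', b', c', d'} \<subseteq> carrier L"
      and w: "word a' = a" "word b' = b" "word c' = c" "word d' = d"
      by auto
    have "generators4 L (a', b', c', d')"
      unfolding generators4_iff[OF assms] w using sub fr by simp
    moreover have "is_char_vector L (a', b', c', d') l"
      unfolding is_char_vector_iff[OF sub] w by (rule l)
    ultimately show "l \<in> char_orbit L" unfolding char_orbit_def by blast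
  qed
qed

end

section \<open>Existence of codes with a given cubic form\<close>

lemma bit_mult_self: "(x :: bit) * x = x" "(x :: bit) * (x * y) = x * y"
  by (cases x; simp)+

fun dot4 :: "bit4 \<Rightarrow> bit4 \<Rightarrow> bit" where
  "dot4 (x1, x2, x3, x4) (y1, y2, y3, y4) = x1 * y1 + x2 * y2 + x3 * y3 + x4 * y4"

text \<open>\<open>ys\<close> lists the columns of a generator matrix; this is the weight of the
  codeword with coordinates \<open>x\<close>, by \<open>card_supp_codeword\<close>.\<close>

definition col_weight :: "bit4 list \<Rightarrow> bit4 \<Rightarrow> nat" where
  "col_weight ys x = length (filter (\<lambda>y. dot4 x y = 1) ys)"

definition has_form :: "bit4 list \<Rightarrow> (bit4 \<Rightarrow> bit) \<Rightarrow> bool" where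
  "has_form ys q \<longleftrightarrow> (\<forall>x. 4 dvd col_weight ys x \<and> of_nat (col_weight ys x div 4) = q x)"

definition opt_block :: "bit \<Rightarrow> bit4 list \<Rightarrow> bit4 list" where
  "opt_block b ys = (if b = 0 then [] else ys)"

lemma col_weight_simps:
  "col_weight [] x = 0"
  "col_weight (y # ys) x = (if dot4 x y = 1 then 1 else 0) + col_weight ys x"
  "col_weight (replicate n y) x = (if dot4 x y = 1 then n else 0)"
  "col_weight (ys @ zs) x = col_weight ys x + col_weight zs x"
  by (simp_all add: col_weight_def)

text \<open>Juxtaposing generator matrices adds weights, and since both weights are multiples of 4
  it adds the forms as well.\<close>

lemma has_form_append:
  assumes "has_form ys p" "has_form zs q"
  shows "has_form (ys @ zs) (\<lambda>x. p x + q x)"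
  unfolding has_form_def
proof
  fix x
  obtain k l where kl: "col_weight ys x = 4 * k" "col_weight zs x = 4 * l"
    using assms unfolding has_form_def by (meson dvdE)
  have "of_nat (col_weight ys x div 4) = p x" "of_nat (col_weight zs x div 4) = q x"
    using assms unfolding has_form_def by blast+
  then have pq: "p x = of_nat k" "q x = of_nat l" by (simp_all add: kl)
  have "col_weight (ys @ zs) x = 4 * (k + l)"
    by (simp add: col_weight_simps kl)
  then show "4 dvd col_weight (ys @ zs) x \<and> of_nat (col_weight (ys @ zs) x div 4) = p x + q x"
    by (simp add: pq)
qed

lemma has_form_opt_block: "has_form ys q \<Longrightarrow> has_form (opt_block b ys) (\<lambda>x. b * q x)"
  by (cases b) (auto simp: has_form_def opt_block_def col_weight_def)

lemma all_bit4: "(\<forall>x :: bit4. P x) \<longleftrightarrow> (\<forall>d\<in>{0, 1}. \<forall>a\<in>{0, 1}. \<forall>b\<in>{0, 1}. \<forall>c\<in>{0, 1}. P (a, b, c, d))"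
  by (auto simp flip: UNIV_bit)

lemma Suc_4_times: "Suc (Suc (Suc (Suc 0))) = 4"
  by simp

text \<open>Four equal columns have weight 0 or 4 and give a coordinate. Multiplicities 6, 6, 2 give
  weight 8 if exactly one of the two coordinates is 1, and 12 if both are, hence their product.
  Eight equal columns have form 0; that block makes codewords depend on the last coordinate without
  changing the form.\<close>

lemma has_form_blocks:
  "has_form [(1, 0, 0, 0), (0, 1, 0, 0), (0, 0, 1, 0), (1, 1, 0, 0), (1, 0, 1, 0), (0, 1, 1, 0), (1, 1, 1, 0)]
     (cubic (1, 1, 1, 0, 1, 1, 0, 1, 0, 0))"
  "has_form (replicate 8 (0, 0, 0, 1)) (\<lambda>x. 0)"
  "has_form (replicate 4 (1, 0, 0, 0)) (\<lambda>(x, y, z, t). x)"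
  "has_form (replicate 4 (0, 1, 0, 0)) (\<lambda>(x, y, z, t). y)"
  "has_form (replicate 4 (0, 0, 1, 0)) (\<lambda>(x, y, z, t). z)"
  "has_form (replicate 4 (0, 0, 0, 1)) (\<lambda>(x, y, z, t). t)"
  "has_form (replicate 6 (1, 0, 0, 0) @ replicate 6 (0, 1, 0, 0) @ replicate 2 (1, 1, 0, 0)) (\<lambda>(x, y, z, t). x * y)"
  "has_form (replicate 6 (1, 0, 0, 0) @ replicate 6 (0, 0, 1, 0) @ replicate 2 (1, 0, 1, 0)) (\<lambda>(x, y, z, t). x * z)"
  "has_form (replicate 6 (1, 0, 0, 0) @ replicate 6 (0, 0, 0, 1) @ replicate 2 (1, 0, 0, 1)) (\<lambda>(x, y, z, t). x * t)"
  "has_form (replicate 6 (0, 1, 0, 0) @ replicate 6 (0, 0, 1, 0) @ replicate 2 (0, 1, 1, 0)) (\<lambda>(x, y, z, t). y * z)"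
  "has_form (replicate 6 (0, 1, 0, 0) @ replicate 6 (0, 0, 0, 1) @ replicate 2 (0, 1, 0, 1)) (\<lambda>(x, y, z, t). y * t)"
  "has_form (replicate 6 (0, 0, 1, 0) @ replicate 6 (0, 0, 0, 1) @ replicate 2 (0, 0, 1, 1)) (\<lambda>(x, y, z, t). z * t)"
  unfolding has_form_def all_bit4
  by (simp_all add: col_weight_simps Suc_4_times del: replicate.simps)

text \<open>The columns spanning the first three coordinates generate the simplex code, whose form is
  \<open>1 + (1 + x) (1 + y) (1 + z)\<close>; the other blocks correct its linear and quadratic part.\<close>

lemma columns_exist:
  "\<exists>ys. has_form ys (cubic l) \<and> (0, 0, 0, 1) \<in> set ys"
proof -
  obtain l1 l2 l3 l4 l5 l6 l7 l8 l9 l10 where l: "l = (l1, l2, l3, l4, l5, l6, l7, l8, l9, l10)"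
    by (cases l rule: vec10.cases) blast
  \<comment> \<open>The simplex block already supplies coefficient 1 in positions 1, 2, 3, 5, 6 and
    8; in exactly these positions the correction is shifted by 1.\<close>
  note blocks = has_form_append[OF has_form_blocks(1) has_form_append[OF has_form_blocks(2)
      has_form_append[OF has_form_opt_block[OF has_form_blocks(3), of "l1 + 1"]
      has_form_append[OF has_form_opt_block[OF has_form_blocks(4), of "l2 + 1"]
      has_form_append[OF has_form_opt_block[OF has_form_blocks(5), of "l3 + 1"]
      has_form_append[OF has_form_opt_block[OF has_form_blocks(6), of l4]
      has_form_append[OF has_form_opt_block[OF has_form_blocks(7), of "l5 + 1"]
      has_form_append[OF has_form_opt_block[OF has_form_blocks(8), of "l6 + 1"]
      has_form_append[OF has_form_opt_block[OF has_form_blocks(9), of l7]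
      has_form_append[OF has_form_opt_block[OF has_form_blocks(10), of "l8 + 1"]
      has_form_append[OF has_form_opt_block[OF has_form_blocks(11), of l9]
      has_form_opt_block[OF has_form_blocks(12), of l10]]]]]]]]]]]]
  have eq: "cubic l = (\<lambda>x. cubic (1, 1, 1, 0, 1, 1, 0, 1, 0, 0) x + (0 +
      ((l1 + 1) * (case x of (x, y, z, t) \<Rightarrow> x) + ((l2 + 1) * (case x of (x, y, z, t) \<Rightarrow> y) +
      ((l3 + 1) * (case x of (x, y, z, t) \<Rightarrow> z) + (l4 * (case x of (x, y, z, t) \<Rightarrow> t) +
      ((l5 + 1) * (case x of (x, y, z, t) \<Rightarrow> x * y) + ((l6 + 1) * (case x of (x, y, z, t) \<Rightarrow> x * z) +
      (l7 * (case x of (x, y, z, t) \<Rightarrow> x * t) + ((l8 + 1) * (case x of (x, y, z, t) \<Rightarrow> y * z) +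
      (l9 * (case x of (x, y, z, t) \<Rightarrow> y * t) + l10 * (case x of (x, y, z, t) \<Rightarrow> z * t))))))))))))"
    by (auto simp: fun_eq_iff l distrib_right bit_ac)
  show ?thesis
    unfolding eq by (intro exI conjI, rule blocks) simp
qed

section \<open>From columns to a doubly even code\<close>

definition codeword :: "bit4 list \<Rightarrow> bit4 \<Rightarrow> bit vec" where
  "codeword ys x = vec (length ys) (\<lambda>i. dot4 x (ys ! i))"

lemma dot4_add4: "dot4 (add4 x y) z = dot4 x z + dot4 y z"
  by (cases x; cases y; cases z) (simp add: algebra_simps)

lemma codeword_add: "codeword ys x + codeword ys y = codeword ys (add4 x y)"
  by (intro eq_vecI) (auto simp: codeword_def dot4_add4)

lemma codeword_carrier [simp]: "codeword ys x \<in> carrier_vec (length ys)"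
  by (simp add: codeword_def)

lemma codeword_zero: "codeword ys (0, 0, 0, 0) = 0\<^sub>v (length ys)"
proof -
  have "dot4 (0, 0, 0, 0) y = 0" for y by (cases y) simp
  then show ?thesis by (intro eq_vecI) (auto simp: codeword_def)
qed

lemma card_supp_codeword: "card (supp (codeword ys x)) = col_weight ys x"
  unfolding supp_def codeword_def col_weight_def length_filter_conv_card
  by (rule arg_cong[of _ _ card]) auto

lemma codeword_smult: "k \<cdot>\<^sub>v codeword ys x = codeword ys (if k = 0 then (0, 0, 0, 0) else x)"
proof (cases "k = 0")
  case True
  have "0 \<cdot>\<^sub>v codeword ys x = 0\<^sub>v (length ys)"
    by (intro eq_vecI) (auto simp: codeword_def)
  then show ?thesis by (simp add: True codeword_zero)
next
  case False
  have "1 \<cdot>\<^sub>v codeword ys x = codeword ys x"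
    by (intro eq_vecI) (auto simp: codeword_def)
  then show ?thesis using False by simp
qed

text \<open>Twice an intersection is \<open>|u| + |v| - |u + v|\<close>, a multiple of 4; so even
  intersections follow from the weights alone.\<close>

lemma double_even_code_codewords:
  assumes "has_form ys q"
  shows "double_even_code (length ys) (range (codeword ys))"
  unfolding double_even_code_def
proof (intro conjI ballI)
  show "VectorSpace.subspace class_ring (range (codeword ys)) (module_vec TYPE(bit) (length ys))"
    unfolding VectorSpace.subspace_def
  proof (intro conjI vec_vs submodule.intro)
    show "module class_ring (module_vec TYPE(bit) (length ys))"
      using vec_vs by (rule vectorspace.axioms(1))
    show "\<zero>\<^bsub>module_vec TYPE(bit) (length ys)\<^esub> \<in> range (codeword ys)"
      unfolding module_vec_simps codeword_zero[symmetric] by (rule rangeI)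
  qed (auto simp: module_vec_simps codeword_add codeword_smult)
  have 4: "4 dvd card (supp (codeword ys x))" for x
    using assms unfolding card_supp_codeword has_form_def by blast
  then show "4 dvd card (supp v)" if "v \<in> range (codeword ys)" for v
    using that by auto
  fix u v assume "u \<in> range (codeword ys)" "v \<in> range (codeword ys)"
  then obtain x y where uv: "u = codeword ys x" "v = codeword ys y" by auto
  have "card (supp (codeword ys (add4 x y))) + 2 * card (supp u \<inter> supp v) = card (supp u) + card (supp v)"
    unfolding uv codeword_add[symmetric] supp_add[OF codeword_carrier codeword_carrier]
    by (rule card_sym_diff) auto
  then show "2 dvd card (supp u \<inter> supp v)"
    using 4[of x] 4[of y] 4[of "add4 x y"] unfolding uv by presburger
qed

text \<open>A polynomial that restricts to \<open>cubic l\<close> on the diagonal: a quadratic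
  monomial is split between the two arguments, and the three cubic terms add up to one copy of
  \<open>x1 * x2 * x3\<close> because 3 is odd. The bilinear part is a cocycle, and the cubic terms
  deviate from one by the determinant.\<close>

fun cubic_factor :: "bit10 \<Rightarrow> bit4 \<Rightarrow> bit4 \<Rightarrow> bit" where
  "cubic_factor (l1, l2, l3, l4, l5, l6, l7, l8, l9, l10) (x1, x2, x3, x4) (y1, y2, y3, y4) =
     l1 * (x1 * y1) + l2 * (x2 * y2) + l3 * (x3 * y3) + l4 * (x4 * y4)
     + l5 * (x1 * y2) + l6 * (x1 * y3) + l7 * (x1 * y4) + l8 * (x2 * y3) + l9 * (x2 * y4) + l10 * (x3 * y4)
     + x1 * x2 * y3 + x1 * x3 * y2 + x2 * x3 * y1"

text \<open>The determinant of the first three coordinates; modulo 2 its signs disappear.\<close>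

fun det_form :: "bit4 \<Rightarrow> bit4 \<Rightarrow> bit4 \<Rightarrow> bit" where
  "det_form (x1, x2, x3, x4) (y1, y2, y3, y4) (z1, z2, z3, z4) =
     x1 * y2 * z3 + x1 * y3 * z2 + x2 * y1 * z3 + x2 * y3 * z1 + x3 * y1 * z2 + x3 * y2 * z1"

text \<open>Differencing three times removes linear and quadratic parts, so the result is the same
  for all \<open>l\<close>. The grouping is that of \<open>form2_add_left\<close> with each
  \<open>wt_form2\<close> expanded as a polarisation.\<close>

lemma cubic_third_difference:
  "cubic l (add4 (add4 x y) z) + cubic l (add4 x y) + cubic l z
     + (cubic l (add4 x z) + cubic l x + cubic l z) + (cubic l (add4 y z) + cubic l y + cubic l z)
   = det_form x y z"
  by (cases l rule: vec10.cases; cases x; cases y; cases z) (simp add: algebra_simps bit_ac)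

lemma cubic_factor_diag: "cubic_factor l x x = cubic l x"
  by (cases l rule: vec10.cases; cases x) (simp add: bit_mult_self bit_ac mult.commute mult.left_commute mult.assoc)

lemma cubic_factor_swap:
  "cubic_factor l x y = (cubic l (add4 x y) + cubic l x + cubic l y) + cubic_factor l y x"
  by (cases l rule: vec10.cases; cases x; cases y) (simp add: algebra_simps bit_ac)

lemma cubic_factor_assoc:
  "cubic_factor l (add4 x y) z =
     cubic_factor l x (add4 y z) + cubic_factor l x y + cubic_factor l y z + det_form x y z"
  by (cases l rule: vec10.cases; cases x; cases y; cases z) (simp add: algebra_simps bit_ac)

text \<open>The columns supply the code and \<open>cubic_factor l\<close>, transported by the
  coordinates of codewords, the factor set. This is used to separate the explored sets and to obtain
  the loops of the list.\<close>

lemma code_loop_exists: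
  "\<exists>m V \<phi>. code_loop m V \<phi> \<and> card V = 16 \<and> l \<in> even_code.char_tuples m V \<and>
     code_dim m V = 4 \<and> nonassociative (loop_of_code m V \<phi>)"
proof -
  obtain ys where ys: "has_form ys (cubic l)" "(0, 0, 0, 1) \<in> set ys"
    using columns_exist by blast
  define m V C where "m = length ys" and "V = range (codeword ys)" and "C = codeword ys"
  interpret even_code m V
    using double_even_code_codewords[OF ys(1)] by unfold_locales (simp add: m_def V_def)
  have CV [simp]: "C x \<in> V" for x by (simp add: C_def V_def)
  have add: "C x + C y = C (add4 x y)" for x y by (simp add: C_def codeword_add)
  have zero: "C (0, 0, 0, 0) = 0\<^sub>v m" by (simp add: C_def m_def codeword_zero)
  have form: "wt_form (C x) = cubic l x" for x
    using ys(1) unfolding wt_form_def C_def card_supp_codeword has_form_def by blast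
  have form2: "wt_form2 (C x) (C y) = cubic l (add4 x y) + cubic l x + cubic l y" for x y
    using form_add[of "C x" "C y"] by (simp add: add form bit_ac)
  have form3: "wt_form3 (C x) (C y) (C z) = det_form x y z" for x y z
    using form2_add_left[of "C x" "C y" "C z"] cubic_third_difference[of l x y z]
    by (simp add: add form2 bit_ac)
  let ?a = "C (1, 0, 0, 0)" and ?b = "C (0, 1, 0, 0)" and ?c = "C (0, 0, 1, 0)" and ?d = "C (0, 0, 0, 1)"
  \<comment> \<open>The column \<open>(0, 0, 0, 1)\<close> puts a 1 into \<open>?d\<close>. The form
    alone could not exclude \<open>?d = 0\<^sub>v m\<close>, since \<open>cubic l\<close> may be
    independent of the last coordinate.\<close>
  have d: "?d \<noteq> 0\<^sub>v m"
  proof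
    assume d0: "?d = 0\<^sub>v m"
    obtain i where i: "i < length ys" "ys ! i = (0, 0, 0, 1)"
      using ys(2) by (auto simp: in_set_conv_nth)
    then have "?d $ i = 1" by (simp add: C_def codeword_def)
    then show False using i unfolding d0 by (simp add: m_def)
  qed
  have "wt_form3 ?d v w = 0" if "v \<in> V" "w \<in> V" for v w
    using that by (auto simp: V_def C_def[symmetric] form3)
  then have fr: "frame ?a ?b ?c ?d"
    using d by (simp add: frame_def form3)
  have "comb ?a ?b ?c ?d x = C x" for x
  proof -
    have sm: "k \<cdot>\<^sub>v C x = C (if k = 0 then (0, 0, 0, 0) else x)" for k x
      unfolding C_def by (rule codeword_smult)
    show ?thesis
      by (cases x; rename_tac a b c d; case_tac a; case_tac b; case_tac c; case_tac d)
        (simp_all add: comb_def sm add)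
  qed
  then have comb: "comb ?a ?b ?c ?d = C" by (rule ext)
  have "inj (comb ?a ?b ?c ?d)"
    using fr by (intro inj_comb) (auto simp: frame_def)
  then have injC: "inj C" unfolding comb .
  then have card: "card V = 16"
    using card_image[of C UNIV] by (simp add: V_def C_def card_UNIV_bit4)
  have "char_tuple ?a ?b ?c ?d = l"
    by (cases l rule: vec10.cases) (simp add: char_tuple_def form form2 bit_ac)
  then have l: "l \<in> char_tuples"
    using fr unfolding char_tuples_def by blast
  define G where "G v w = cubic_factor l (inv_into UNIV C v) (inv_into UNIV C w)" for v w
  define \<phi> where "\<phi> v w = bsign (G v w)" for v w
  have G: "G (C x) (C y) = cubic_factor l x y" for x y
    by (simp add: G_def inv_f_f[OF injC])
  have VC: "(\<forall>v\<in>V. P v) \<longleftrightarrow> (\<forall>x. P (C x))" for P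
    by (simp add: V_def C_def)
  have "cubic_factor l (0, 0, 0, 0) x = 0" "cubic_factor l x (0, 0, 0, 0) = 0" for x
    by (cases l rule: vec10.cases; cases x; simp)+
  note zeros = this
  have "factor_set m V \<phi>"
  proof (rule factor_set_iff_bit[of V \<phi> G m, THEN iffD2])
    show "\<forall>v\<in>V. \<forall>w\<in>V. \<phi> v w = bsign (G v w)" by (simp add: \<phi>_def)
    show "even_code m V" by (rule even_code_axioms)
    show "(\<forall>v\<in>V. G v v = wt_form v) \<and> (\<forall>v\<in>V. \<forall>w\<in>V. G v w = wt_form2 v w + G w v) \<and>
        (\<forall>v\<in>V. G (0\<^sub>v m) v = 0 \<and> G v (0\<^sub>v m) = 0) \<and>
        (\<forall>v\<in>V. \<forall>w\<in>V. \<forall>u\<in>V. G (v + w) u = G v (w + u) + G v w + G w u + wt_form3 v w u)"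
      unfolding VC zero[symmetric] add G form form2 form3 zeros
      using cubic_factor_diag cubic_factor_swap cubic_factor_assoc by blast
  qed
  then interpret code_loop m V \<phi>
    by unfold_locales
  interpret coded_loop m V \<phi> "loop_of_code m V \<phi>" id
    using alg_loop_loop_of_code iso_set_refl
    by (intro coded_loop.intro code_loop_axioms coded_loop_axioms.intro) (auto simp: id_def)
  have "word (1, v) = v" for v :: "bit vec" by (simp add: word_def)
  moreover have "wt_form3 ?a ?b ?c = 1" using fr by (simp add: frame_def)
  ultimately have "nonassociative (loop_of_code m V \<phi>)"
    unfolding nonassociative_def
    using assoc_iff[of "(1, ?a)" "(1, ?b)" "(1, ?c)"]
    by (intro bexI[of _ "(1, ?a)"] bexI[of _ "(1, ?b)"] bexI[of _ "(1, ?c)"]) auto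
  then show ?thesis
    using code_loop_axioms card l code_dim_4I[OF card] by blast
qed

section \<open>Orbits of characteristic vectors\<close>

text \<open>The effect on the characteristic vector of replacing \<open>a\<close> by \<open>a + b\<close> or \<open>a + d\<close> and of
  exchanging \<open>a, b\<close> or \<open>b, c\<close>.\<close>

fun moves :: "bit10 \<Rightarrow> bit10 list" where
  "moves (l1, l2, l3, l4, l5, l6, l7, l8, l9, l10) =
    [(l1 + l2 + l5, l2, l3, l4, l5, l6 + l8 + 1, l7 + l9, l8, l9, l10),
     (l1 + l4 + l7, l2, l3, l4, l5 + l9, l6 + l10, l7, l8, l9, l10),
     (l2, l1, l3, l4, l5, l8, l9, l6, l7, l10),
     (l1, l3, l2, l4, l6, l5, l7, l8, l10, l9)]"

function explore :: "bit10 list \<Rightarrow> bit10 list \<Rightarrow> bit10 list" where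
  "explore seen [] = seen"
| "explore seen (x # xs) =
    (if x \<in> set seen then explore seen xs else explore (x # seen) (moves x @ xs))"
  by pat_completeness auto
termination
proof (relation "measures [\<lambda>(seen, _). card (- set seen), \<lambda>(_, xs). length xs]")
  fix seen :: "bit10 list" and x xs
  assume "\<not> x \<in> set seen"
  have "- set (x # seen) \<subset> - set seen" using \<open>\<not> _\<close> by auto
  then have "card (- set (x # seen)) < card (- set seen)"
    by (rule psubset_card_mono[OF finite_subset[OF subset_UNIV finite_UNIV_bit10]])
  then show "((x # seen, moves x @ xs), seen, x # xs) \<in> measures [\<lambda>(seen, _). card (- set seen), \<lambda>(_, xs). length xs]"
    by simp
qed auto

declare explore.simps [simp del]

definition reps :: "bit10 list" where
  "reps =
    [(1,1,1,0,1,1,0,1,0,0),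
     (0,0,0,0,0,0,0,0,0,0),
     (0,0,0,0,1,1,0,1,0,0),
     (0,0,1,0,1,0,0,0,0,0),
     (0,0,0,0,0,1,0,1,0,0),
     (1,1,1,1,1,1,0,1,0,0),
     (0,0,0,1,0,0,0,0,0,0),
     (0,0,0,0,0,0,1,0,0,0),
     (0,1,0,0,0,0,1,0,0,0),
     (0,0,0,1,1,1,1,0,0,0),
     (0,0,0,1,0,0,1,0,0,0),
     (0,0,0,0,0,0,1,1,0,0),
     (0,1,1,0,1,1,1,1,0,0),
     (0,0,0,1,0,0,1,1,0,0),
     (1,0,0,1,0,0,1,1,0,0),
     (0,0,0,1,1,1,1,1,0,0)]"

text \<open>The entries divide 1344, the number of frames in a code with 16 words that has one, and
  add up to 1024. The third entry, absent from the sizes in the theorem, takes part in this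
  sum.\<close>

definition orbit_sizes :: "nat list" where
  "orbit_sizes = [1, 7, 7, 21, 28, 8, 56, 56, 168, 112, 112, 168, 56, 28, 28, 168]"

definition orb :: "nat \<Rightarrow> bit10 set" where
  "orb i = set (explore [] [reps ! i])"

definition points :: "bit4 list" where
  "points = concat (map (\<lambda>x. concat (map (\<lambda>y. concat (map (\<lambda>z. map (\<lambda>t. (x, y, z, t)) [0, 1])
     [0, 1])) [0, 1])) [0, 1])"

text \<open>The number of codewords with form 1 and the number of pairs of codewords such that both of
  them and their sum have form 1; these two numbers separate the 16 representatives.\<close>

definition invariant :: "bit10 \<Rightarrow> nat \<times> nat" where
  "invariant l = (length (filter (\<lambda>x. cubic l x = 1) points),
     length (filter (\<lambda>(x, y). cubic l x = 1 \<and> cubic l y = 1 \<and> cubic l (add4 x y) = 1)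
       (List.product points points)))"

text \<open>Equations by values let \<open>code_simp\<close> compute with bits.\<close>

lemma plus_bit_code [code]:
  "(0 :: bit) + x = x" "(x :: bit) + 0 = x" "(1 :: bit) + 1 = 0"
  by simp_all

lemma times_bit_code [code]:
  "(0 :: bit) * x = 0" "(1 :: bit) * x = x"
  by simp_all

lemma length_reps [simp]: "length reps = 16"
  by (simp add: reps_def)


text \<open>Representing the visited vectors by a binary tree keeps the evaluation of the orbit sizes short.\<close>

datatype trie = Empty | Node trie trie

fun in_trie :: "bit list \<Rightarrow> trie \<Rightarrow> bool" where
  "in_trie k Empty \<longleftrightarrow> False"
| "in_trie [] (Node l r) \<longleftrightarrow> True"
| "in_trie (b # k) (Node l r) \<longleftrightarrow> (if b = 0 then in_trie k l else in_trie k r)"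

fun trie_insert :: "bit list \<Rightarrow> trie \<Rightarrow> trie" where
  "trie_insert [] t = Node Empty Empty"
| "trie_insert (b # k) Empty = (if b = 0 then Node (trie_insert k Empty) Empty else Node Empty (trie_insert k Empty))"
| "trie_insert (b # k) (Node l r) = (if b = 0 then Node (trie_insert k l) r else Node l (trie_insert k r))"

text \<open>Equal lengths matter: inserting at the end of a key overwrites whatever subtree hangs
  there.\<close>

lemma in_trie_insert:
  "length k = length k' \<Longrightarrow> in_trie k' (trie_insert k t) \<longleftrightarrow> k' = k \<or> in_trie k' t"
proof (induction k arbitrary: k' t)
  case (Cons b k)
  then obtain b' k'' where k': "k' = b' # k''" by (cases k') auto
  show ?case using Cons by (cases t; cases b; cases b') (auto simp: k')
qed auto

fun key :: "bit10 \<Rightarrow> bit list" where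
  "key (l1, l2, l3, l4, l5, l6, l7, l8, l9, l10) = [l1, l2, l3, l4, l5, l6, l7, l8, l9, l10]"

lemma key_insert: "in_trie (key y) (trie_insert (key x) t) \<longleftrightarrow> y = x \<or> in_trie (key y) t"
  by (subst in_trie_insert; cases x rule: key.cases; cases y rule: key.cases) auto

function count_orbit :: "trie \<Rightarrow> nat \<Rightarrow> bit10 list \<Rightarrow> nat" where
  "count_orbit t n [] = n"
| "count_orbit t n (x # xs) =
    (if in_trie (key x) t then count_orbit t n xs
     else count_orbit (trie_insert (key x) t) (Suc n) (moves x @ xs))"
  by pat_completeness auto
termination
proof (relation "measures [\<lambda>(t, _, _). card {x. \<not> in_trie (key x) t}, \<lambda>(_, _, xs). length xs]")
  fix t n x xs
  assume "\<not> in_trie (key x) t"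
  have "{y. \<not> in_trie (key y) (trie_insert (key x) t)} \<subset> {y. \<not> in_trie (key y) t}"
    using \<open>\<not> _\<close> key_insert by blast
  then have "card {y. \<not> in_trie (key y) (trie_insert (key x) t)} < card {y. \<not> in_trie (key y) t}"
    by (rule psubset_card_mono[OF finite_subset[OF subset_UNIV finite_UNIV_bit10]])
  then show "((trie_insert (key x) t, Suc n, moves x @ xs), t, n, x # xs) \<in>
    measures [\<lambda>(t, _, _). card {x. \<not> in_trie (key x) t}, \<lambda>(_, _, xs). length xs]"
    by simp
qed auto

text \<open>Both recursions take the same branches as long as the trie represents
  \<open>set seen\<close>, so the cheap count is the length of the explored list.\<close>

lemma count_orbit_eq:
  "(\<And>y. in_trie (key y) t \<longleftrightarrow> y \<in> set seen) \<Longrightarrow> count_orbit t (length seen) xs = length (explore seen xs)"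
proof (induction seen xs arbitrary: t rule: explore.induct)
  case (2 seen x xs)
  then show ?case
    by (auto simp: explore.simps key_insert simp del: key.simps)
qed (simp add: explore.simps)

lemma length_explore: "map (\<lambda>r. length (explore [] [r])) reps = orbit_sizes"
proof -
  have "length (explore [] [r]) = count_orbit Empty 0 [r]" for r
    using count_orbit_eq[of Empty "[]" "[r]"] by simp
  moreover have "map (\<lambda>r. count_orbit Empty 0 [r]) reps = orbit_sizes"
    by code_simp
  ultimately show ?thesis by simp
qed

lemma distinct_invariants: "distinct (map invariant reps)"
  by code_simp

lemma points: "distinct points" "set points = UNIV"
proof -
  show "distinct points" by (simp add: points_def)
  have "x \<in> set points" for x
    by (cases x; rename_tac a b c d; case_tac a; case_tac b; case_tac c; case_tac d)
      (simp_all add: points_def)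
  then show "set points = UNIV" by blast
qed

text \<open>Each move undoes itself, since adding a vector twice cancels and exchanges are
  involutions.\<close>

lemma moves_involutive: "y \<in> set (moves x) \<Longrightarrow> x \<in> set (moves y)"
proof -
  have "\<forall>y\<in>set (moves x). x \<in> set (moves y)"
    by (cases x rule: vec10.cases) (simp add: bit_ac)
  then show "y \<in> set (moves x) \<Longrightarrow> x \<in> set (moves y)" by blast
qed

lemma distinct_explore: "distinct seen \<Longrightarrow> distinct (explore seen xs)"
  by (induction seen xs rule: explore.induct) (auto simp: explore.simps)

lemma subset_explore: "set seen \<union> set xs \<subseteq> set (explore seen xs)"
  by (induction seen xs rule: explore.induct) (auto simp: explore.simps)

text \<open>Moves are reversible, so a property that they preserve holds on all of an explored set
  or nowhere on it; \<open>Q\<close> is the common truth value.\<close>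

lemma explore_invariant:
  assumes "\<And>x y. y \<in> set (moves x) \<Longrightarrow> P x \<Longrightarrow> P y"
  shows "\<forall>x \<in> set seen \<union> set xs. P x \<longleftrightarrow> Q \<Longrightarrow> \<forall>x \<in> set (explore seen xs). P x \<longleftrightarrow> Q"
proof (induction seen xs rule: explore.induct)
  case (1 seen)
  then show ?case by (simp only: explore.simps list.set Un_empty_right)
next
  case (2 seen y ys)
  show ?case
  proof (cases "y \<in> set seen")
    case True
    have "\<forall>x \<in> set seen \<union> set ys. P x \<longleftrightarrow> Q"
      using "2.prems" unfolding list.set by blast
    then show ?thesis
      using "2.IH"(1)[OF True] True by (simp only: explore.simps if_True)
  next
    case False
    have "P z \<longleftrightarrow> P y" if "z \<in> set (moves y)" for z
      using assms that moves_involutive by blast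
    then have "\<forall>x \<in> set (y # seen) \<union> set (moves y @ ys). P x \<longleftrightarrow> Q"
      using "2.prems" unfolding list.set set_append by blast
    then show ?thesis
      using "2.IH"(2)[OF False] False by (simp only: explore.simps if_False)
  qed
qed

lemma rep_in_orb: "reps ! i \<in> orb i"
  using subset_explore[of "[]" "[reps ! i]"] by (auto simp: orb_def)

lemma card_orb: "i < 16 \<Longrightarrow> card (orb i) = orbit_sizes ! i"
  unfolding orb_def length_explore[symmetric]
  by (simp add: distinct_card[OF distinct_explore])

lemma bij_betw_card_Collect:
  assumes "bij_betw f UNIV A"
  shows "card {x. P (f x)} = card {y \<in> A. P y}"
proof -
  have "bij_betw f {x. P (f x)} {y \<in> A. P y}"
    using assms by (auto simp: bij_betw_def inj_on_def)
  then show ?thesis by (rule bij_betw_same_card)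
qed

section \<open>Characteristic tuples of one code: moves and invariants\<close>

context even_code
begin

text \<open>Adding \<open>b\<close> to \<open>a\<close> keeps a frame because the trilinear form is
  alternating, adding \<open>d\<close> because \<open>d\<close> is in its radical. The constant 1 in
  the first move is \<open>wt_form3 a b c\<close>, coming from
  \<open>form2_add_left\<close>.\<close>

lemma char_tuples_moves:
  assumes "x \<in> char_tuples" "y \<in> set (moves x)"
  shows "y \<in> char_tuples"
proof -
  obtain a b c d where fr: "frame a b c d" and x: "x = char_tuple a b c d"
    using assms(1) by (auto simp: char_tuples_def)
  have V [simp]: "a \<in> V" "b \<in> V" "c \<in> V" "d \<in> V" and T: "wt_form3 a b c = 1"
    and d: "d \<noteq> 0\<^sub>v m" "\<And>u v. u \<in> V \<Longrightarrow> v \<in> V \<Longrightarrow> wt_form3 d u v = 0"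
    using fr by (auto simp: frame_def)
  have T': "wt_form3 b a c = 1" "wt_form3 a c b = 1"
    using T by (metis form3_perm)+
  have d': "wt_form3 u d v = 0" "wt_form3 u v d = 0" if "u \<in> V" "v \<in> V" for u v
    using d(2)[OF that] by (metis form3_perm)+
  have f: "frame (a + b) b c d" "frame (a + d) b c d" "frame b a c d" "frame a c b d"
    using T T' d by (simp_all add: frame_def form3_add)
  have "y \<in> {char_tuple (a + b) b c d, char_tuple (a + d) b c d, char_tuple b a c d, char_tuple a c b d}"
    using assms(2) unfolding x char_tuple_def moves.simps
    by (simp add: form_add form2_add_left T d d' form2_sym[of b a] form2_sym[of c b] form2_sym[of d b] form2_sym[of d c])
  then show ?thesis using f unfolding char_tuples_def by blast
qed

lemma orb_char_tuples: "x \<in> orb i \<Longrightarrow> x \<in> char_tuples \<longleftrightarrow> reps ! i \<in> char_tuples"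
  unfolding orb_def
  using explore_invariant[of "\<lambda>x. x \<in> char_tuples" "[]" "[reps ! i]" "reps ! i \<in> char_tuples"]
    char_tuples_moves by simp

text \<open>The coordinate map is a bijection that turns \<open>add4\<close> into addition of
  codewords, so counts over \<open>points\<close> are counts over \<open>V\<close>. No frame is
  mentioned on the right, hence all characteristic tuples of one code share their
  invariants.\<close>

lemma invariant_unique:
  assumes card: "card V = 16" and "x \<in> char_tuples"
  shows "invariant x = (card {v \<in> V. wt_form v = 1},
    card {(v, w) \<in> V \<times> V. wt_form v = 1 \<and> wt_form w = 1 \<and> wt_form (v + w) = 1})"
proof -
  obtain a b c d where fr: "frame a b c d" and x: "x = char_tuple a b c d"
    using assms(2) by (auto simp: char_tuples_def)
  let ?c = "comb a b c d"
  have V: "a \<in> V" "b \<in> V" "c \<in> V" "d \<in> V" using fr by (auto simp: frame_def)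
  have bij: "bij_betw ?c UNIV V" by (rule frame_bij[OF fr card])
  have form: "cubic x u = wt_form (?c u)" for u
    by (simp add: form_comb[OF fr] x)
  have "length (filter (\<lambda>u. cubic x u = 1) points) = card {u. wt_form (?c u) = 1}"
    using distinct_length_filter[OF points(1)] by (simp add: points(2) form)
  then have 1: "length (filter (\<lambda>u. cubic x u = 1) points) = card {v \<in> V. wt_form v = 1}"
    using bij_betw_card_Collect[OF bij] by simp
  let ?P = "\<lambda>(v, w). wt_form v = 1 \<and> wt_form w = 1 \<and> wt_form (v + w) = 1"
  have bij2: "bij_betw (map_prod ?c ?c) UNIV (V \<times> V)"
    using bij_betw_map_prod[OF bij bij] by simp
  have "(\<lambda>(u, v). cubic x u = 1 \<and> cubic x v = 1 \<and> cubic x (add4 u v) = 1) = (\<lambda>p. ?P (map_prod ?c ?c p))"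
    by (auto simp: form comb_add[OF V])
  then have "length (filter (\<lambda>(u, v). cubic x u = 1 \<and> cubic x v = 1 \<and> cubic x (add4 u v) = 1)
      (List.product points points)) = card {p. ?P (map_prod ?c ?c p)}"
    using distinct_length_filter[OF distinct_product[OF points(1) points(1)]] by (simp add: points(2))
  then have 2: "length (filter (\<lambda>(u, v). cubic x u = 1 \<and> cubic x v = 1 \<and> cubic x (add4 u v) = 1)
      (List.product points points)) = card {p \<in> V \<times> V. ?P p}"
    using bij_betw_card_Collect[OF bij2, of ?P] by simp
  have "{p \<in> V \<times> V. ?P p} = {(v, w) \<in> V \<times> V. wt_form v = 1 \<and> wt_form w = 1 \<and> wt_form (v + w) = 1}"
    by auto
  then show ?thesis unfolding invariant_def 1 2 by simp
qed

lemma rep_unique: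
  assumes "card V = 16" "i < 16" "j < 16" "reps ! i \<in> char_tuples" "reps ! j \<in> char_tuples"
  shows "i = j"
proof -
  have "invariant (reps ! i) = invariant (reps ! j)"
    using invariant_unique assms by simp
  then show ?thesis
    using nth_eq_iff_index_eq[OF distinct_invariants, of i j] assms(2,3) by simp
qed

end

text \<open>A common element is viewed in a code that realises \<open>reps ! i\<close>. Running the
  moves backwards, that code realises \<open>reps ! j\<close> too, and the invariants of two
  representatives in one code coincide.\<close>

lemma orb_disjoint:
  assumes "i < 16" "j < 16" "i \<noteq> j"
  shows "orb i \<inter> orb j = {}"
proof (rule ccontr)
  assume "orb i \<inter> orb j \<noteq> {}"
  then obtain x where x: "x \<in> orb i" "x \<in> orb j" by blast
  obtain m V \<phi> where "code_loop m V \<phi>" and card: "card V = 16"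
    and i: "reps ! i \<in> even_code.char_tuples m V"
    using code_loop_exists by metis
  then interpret code_loop m V \<phi> by simp
  have "reps ! j \<in> char_tuples"
    using orb_char_tuples x i by blast
  then show False using rep_unique[OF card assms(1,2) i] assms(3) by simp
qed

lemma orb_cover: "(\<Union>i<16. orb i) = UNIV"
proof -
  have "card (\<Union>i<16. orb i) = (\<Sum>i<16. card (orb i))"
    using orb_disjoint by (intro card_UN_disjoint) (auto simp: orb_def)
  also have "\<dots> = (\<Sum>i<16. orbit_sizes ! i)"
    using card_orb by simp
  also have "\<dots> = 1024" by (simp add: orbit_sizes_def eval_nat_numeral)
  also have "\<dots> = card (UNIV :: bit10 set)"
    by (simp add: card_UNIV_bit card_cartesian_product flip: UNIV_Times_UNIV)
  finally show ?thesis using finite_UNIV_bit10 by (simp add: card_subset_eq)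
qed

text \<open>Here arbitrary base changes are compared with the moves: by \<open>orb_cover\<close>
  every characteristic tuple lies in some \<open>orb j\<close>, and \<open>rep_unique\<close> leaves
  only \<open>j = i\<close>.\<close>

lemma (in even_code) char_tuples_eq_orb:
  assumes card: "card V = 16" and i: "i < 16" "reps ! i \<in> char_tuples"
  shows "char_tuples = orb i"
proof
  show "orb i \<subseteq> char_tuples" using orb_char_tuples i(2) by blast
  show "char_tuples \<subseteq> orb i"
  proof
    fix x assume x: "x \<in> char_tuples"
    obtain j where j: "j < 16" "x \<in> orb j" using orb_cover by blast
    then have "reps ! j \<in> char_tuples" using orb_char_tuples x by blast
    then show "x \<in> orb i" using rep_unique[OF card i(1) j(1) i(2)] j(2) by simp
  qed
qed

section \<open>Classification\<close>

lemma iso_inverse: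
  assumes "f \<in> iso G H" "alg_loop G"
  shows "inv_into (carrier G) f \<in> iso H G"
proof -
  have bij: "bij_betw f (carrier G) (carrier H)"
    and hom: "\<And>x y. x \<in> carrier G \<Longrightarrow> y \<in> carrier G \<Longrightarrow> f (x \<otimes>\<^bsub>G\<^esub> y) = f x \<otimes>\<^bsub>H\<^esub> f y"
    using assms(1) by (auto simp: iso_def hom_def)
  let ?g = "inv_into (carrier G) f"
  have bij': "bij_betw ?g (carrier H) (carrier G)"
    by (rule bij_betw_inv_into[OF bij])
  have "?g (x \<otimes>\<^bsub>H\<^esub> y) = ?g x \<otimes>\<^bsub>G\<^esub> ?g y" if "x \<in> carrier H" "y \<in> carrier H" for x y
  proof -
    have g: "?g x \<in> carrier G" "?g y \<in> carrier G" "f (?g x) = x" "f (?g y) = y"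
      using bij_betw_apply[OF bij'] bij_betw_inv_into_right[OF bij] that by auto
    have "?g (f (?g x \<otimes>\<^bsub>G\<^esub> ?g y)) = ?g x \<otimes>\<^bsub>G\<^esub> ?g y"
      using alg_loop.m_closed[OF assms(2) g(1,2)] by (rule bij_betw_inv_into_left[OF bij])
    then show ?thesis using hom[OF g(1,2)] g(3,4) by simp
  qed
  then show ?thesis
    using bij' bij_betw_apply[OF bij'] by (auto simp: iso_def intro: homI)
qed

lemma code_loop_coding:
  assumes "code_loop_of_rank 4 L" "nonassociative L"
  obtains m V \<phi> f where "nonassoc_coded_loop m V \<phi> L f" "card V = 16"
proof -
  obtain m V \<phi> f where *: "double_even_code m V" "factor_set m V \<phi>" "code_dim m V = 4"
      "f \<in> iso L (loop_of_code m V \<phi>)" "alg_loop L"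
    using assms(1) by (auto simp: code_loop_of_rank_def is_iso_def)
  have "nonassoc_coded_loop m V \<phi> L f"
    by (intro nonassoc_coded_loop.intro nonassoc_coded_loop_axioms.intro coded_loop.intro code_loop.intro
        even_code.intro code_loop_axioms.intro coded_loop_axioms.intro * assms(2))
  moreover have "card V = 16"
    using even_code.card_V[OF even_code.intro, OF *(1)] *(3) by simp
  ultimately show ?thesis by (rule that)
qed

text \<open>Nonassociativity provides a triple with trilinear value 1, which extends to a frame; its
  tuple selects the explored set.\<close>

lemma char_orbit_classify:
  assumes "code_loop_of_rank 4 L" "nonassociative L"
  shows "\<exists>i<16. char_orbit L = vec10 ` orb i"
proof -
  obtain m V \<phi> f where "nonassoc_coded_loop m V \<phi> L f" and card: "card V = 16"
    using assms by (rule code_loop_coding)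
  then interpret nonassoc_coded_loop m V \<phi> L f by simp
  obtain x y z where "x \<in> carrier L" "y \<in> carrier L" "z \<in> carrier L"
    "wt_form3 (word x) (word y) (word z) = 1" by (rule obtain_nonassoc)
  then obtain d where "frame (word x) (word y) (word z) d"
    using frame_exists[OF word_closed word_closed word_closed _ card] by blast
  then obtain l where l: "l \<in> char_tuples" unfolding char_tuples_def by blast
  obtain i where i: "i < 16" "l \<in> orb i" using orb_cover by blast
  then have "char_tuples = orb i"
    using char_tuples_eq_orb[OF card] orb_char_tuples l by blast
  then show ?thesis using char_orbit_eq[OF card] i(1) by auto
qed

text \<open>A coding of \<open>L'\<close> composed with \<open>h\<close> codes \<open>L\<close> over
  the same \<open>V\<close>, and by \<open>char_orbit_eq\<close> the orbit depends on
  \<open>V\<close> alone.\<close>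

lemma char_orbit_iso:
  assumes "code_loop_of_rank 4 L" "nonassociative L" "code_loop_of_rank 4 L'" "nonassociative L'"
    and h: "h \<in> iso L L'"
  shows "char_orbit L = char_orbit L'"
proof -
  obtain m V \<phi> f where "nonassoc_coded_loop m V \<phi> L' f" and card: "card V = 16"
    using assms(3,4) by (rule code_loop_coding)
  then interpret B: nonassoc_coded_loop m V \<phi> L' f by simp
  have "f \<circ> h \<in> iso L (loop_of_code m V \<phi>)"
    using h B.f by (rule iso_set_trans)
  moreover have "alg_loop L" using assms(1) by (simp add: code_loop_of_rank_def)
  ultimately interpret A: nonassoc_coded_loop m V \<phi> L "f \<circ> h"
    using assms(2) B.code_loop_axioms
    by (intro nonassoc_coded_loop.intro nonassoc_coded_loop_axioms.intro coded_loop.intro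
        coded_loop_axioms.intro)
  show ?thesis using A.char_orbit_eq[OF card] B.char_orbit_eq[OF card] by simp
qed

lemma iso_if_common_char_vector:
  assumes L: "code_loop_of_rank 4 L" "nonassociative L"
    and L': "code_loop_of_rank 4 L'" "nonassociative L'"
    and l: "l \<in> char_orbit L" "l \<in> char_orbit L'"
  shows "L \<cong> L'"
proof -
  obtain m V \<phi> f where "nonassoc_coded_loop m V \<phi> L f" and card: "card V = 16"
    using L by (rule code_loop_coding)
  then interpret A: nonassoc_coded_loop m V \<phi> L f by simp
  obtain m' V' \<phi>' f' where "nonassoc_coded_loop m' V' \<phi>' L' f'" and card': "card V' = 16"
    using L' by (rule code_loop_coding)
  then interpret B: nonassoc_coded_loop m' V' \<phi>' L' f' by simp
  obtain x where x: "x \<in> A.char_tuples" "l = vec10 x"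
    using l(1) A.char_orbit_eq[OF card] by blast
  obtain y where y: "y \<in> B.char_tuples" "l = vec10 y"
    using l(2) B.char_orbit_eq[OF card'] by blast
  have "x = y" using x(2) y(2) inj_vec10 by (simp add: inj_eq)
  obtain a b c d where A: "A.frame a b c d" "x = A.char_tuple a b c d"
    using x(1) unfolding A.char_tuples_def by blast
  obtain a' b' c' d' where B: "B.frame a' b' c' d'" "y = B.char_tuple a' b' c' d'"
    using y(1) unfolding B.char_tuples_def by blast
  have "A.char_tuple a b c d = B.char_tuple a' b' c' d'"
    using A(2) B(2) \<open>x = y\<close> by simp
  then obtain h where "h \<in> iso (loop_of_code m V \<phi>) (loop_of_code m' V' \<phi>')"
    using loop_of_code_iso[OF A.code_loop_axioms B.code_loop_axioms A(1) B(1) card card'] by blast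
  then have "h \<circ> f \<in> iso L (loop_of_code m' V' \<phi>')"
    using A.f iso_set_trans by blast
  then have "inv_into (carrier L') f' \<circ> (h \<circ> f) \<in> iso L L'"
    using iso_inverse[OF B.f B.loop] by (rule iso_set_trans)
  then show ?thesis by (rule is_isoI)
qed

lemma char_list_eq:
  assumes "i < 16"
  shows "vec_of_list (char_list ! i) = vec10 (reps ! i)"
proof -
  have "map vec_of_list char_list = map vec10 reps"
    by (simp add: char_list_def reps_def)
  moreover have "length char_list = 16" by (simp add: char_list_def)
  ultimately show ?thesis using assms by (metis length_reps nth_map)
qed

text \<open>The orbit of a loop is one of 16 disjoint explored sets, so a single vector identifies
  it.\<close>

lemma is_C4_iff:
  assumes "i \<in> {1..16}"
  shows "is_C4 i L \<longleftrightarrow> code_loop_of_rank 4 L \<and> nonassociative L \<and> char_orbit L = vec10 ` orb (i - 1)"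
proof -
  have i: "i - 1 < 16" using assms by auto
  have "vec10 (reps ! (i - 1)) \<in> char_orbit L \<longleftrightarrow> char_orbit L = vec10 ` orb (i - 1)"
    if L: "code_loop_of_rank 4 L" "nonassociative L"
  proof
    assume *: "vec10 (reps ! (i - 1)) \<in> char_orbit L"
    obtain j where j: "j < 16" "char_orbit L = vec10 ` orb j"
      using char_orbit_classify[OF L] by blast
    then have "reps ! (i - 1) \<in> orb j"
      using * inj_vec10 by (simp add: inj_image_mem_iff)
    then have "j = i - 1"
      using orb_disjoint[OF j(1) i] rep_in_orb[of "i - 1"] by blast
    then show "char_orbit L = vec10 ` orb (i - 1)" using j by simp
  qed (use rep_in_orb in simp)
  then show ?thesis unfolding is_C4_def char_list_eq[OF i] by blast
qed

lemma is_C4_exists: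
  assumes "i \<in> {1..16}"
  shows "\<exists>C :: (int \<times> bit vec) monoid. is_C4 i C"
proof -
  obtain m V \<phi> where "code_loop m V \<phi>" and card: "card V = 16"
    and l: "reps ! (i - 1) \<in> even_code.char_tuples m V" and dim4: "code_dim m V = 4"
    and na: "nonassociative (loop_of_code m V \<phi>)"
    using code_loop_exists[of "reps ! (i - 1)"] by blast
  then interpret code_loop m V \<phi> by simp
  interpret nonassoc_coded_loop m V \<phi> "loop_of_code m V \<phi>" id
    using alg_loop_loop_of_code iso_set_refl na
    by (intro nonassoc_coded_loop.intro nonassoc_coded_loop_axioms.intro coded_loop.intro
        code_loop_axioms coded_loop_axioms.intro) (auto simp: id_def)
  have "code_loop_of_rank 4 (loop_of_code m V \<phi>)"
    unfolding code_loop_of_rank_def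
    by (intro conjI exI[of _ m] exI[of _ V] exI[of _ \<phi>] alg_loop_loop_of_code code factor dim4 iso_refl)
  moreover have "vec10 (reps ! (i - 1)) \<in> char_orbit (loop_of_code m V \<phi>)"
    using l by (simp add: char_orbit_eq[OF card])
  moreover have "i - 1 < 16" using assms by auto
  ultimately have "is_C4 i (loop_of_code m V \<phi>)"
    using na by (simp add: is_C4_def char_list_eq)
  then show ?thesis by blast
qed

lemma card_char_orbit:
  assumes "is_C4 i L" "i \<in> {1..16}"
  shows "card (char_orbit L) = orbit_sizes ! (i - 1)"
proof -
  have "card (char_orbit L) = card (orb (i - 1))"
    using assms(1) card_image[OF inj_on_subset[OF inj_vec10 subset_UNIV]]
    unfolding is_C4_iff[OF assms(2)] by simp
  also have "i - 1 < 16" using assms(2) by auto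
  then have "card (orb (i - 1)) = orbit_sizes ! (i - 1)"
    by (rule card_orb)
  finally show ?thesis .
qed

text \<open>The listed loops are specified only up to isomorphism, hence the quantification over all
  families \<open>C\<close>; the first conjunct exhibits one.\<close>

theorem theorem4:
  shows "(\<exists>C :: nat \<Rightarrow> (int \<times> bit vec) monoid. \<forall>i\<in>{1..16}. is_C4 i (C i)) \<and>
    (\<forall>C :: nat \<Rightarrow> 'a monoid. (\<forall>i\<in>{1..16}. is_C4 i (C i)) \<longrightarrow>
      (\<forall>L :: 'b monoid. code_loop_of_rank 4 L \<and> nonassociative L \<longrightarrow>
         (\<exists>i\<in>{1..16}. L \<cong> C i)) \<and>
      (\<forall>i\<in>{1..16}. \<forall>j\<in>{1..16}. i \<noteq> j \<longrightarrow> \<not> C i \<cong> C j) \<and>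
      card (char_orbit (C 1)) = 1 \<and>
      card (char_orbit (C 2)) = 7 \<and>
      card (char_orbit (C 4)) = 21 \<and>
      card (char_orbit (C 5)) = 28 \<and>
      card (char_orbit (C 14)) = 28 \<and>
      card (char_orbit (C 15)) = 28 \<and>
      card (char_orbit (C 6)) = 8 \<and>
      card (char_orbit (C 7)) = 56 \<and>
      card (char_orbit (C 8)) = 56 \<and>
      card (char_orbit (C 13)) = 56 \<and>
      card (char_orbit (C 9)) = 168 \<and>
      card (char_orbit (C 12)) = 168 \<and>
      card (char_orbit (C 16)) = 168 \<and>
      card (char_orbit (C 10)) = 112 \<and>
      card (char_orbit (C 11)) = 112)"
proof (rule conjI)
  show "\<exists>C :: nat \<Rightarrow> (int \<times> bit vec) monoid. \<forall>i\<in>{1..16}. is_C4 i (C i)"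
    using is_C4_exists by (intro bchoice) blast
next
  show "\<forall>C :: nat \<Rightarrow> 'a monoid. (\<forall>i\<in>{1..16}. is_C4 i (C i)) \<longrightarrow>
      (\<forall>L :: 'b monoid. code_loop_of_rank 4 L \<and> nonassociative L \<longrightarrow>
         (\<exists>i\<in>{1..16}. L \<cong> C i)) \<and>
      (\<forall>i\<in>{1..16}. \<forall>j\<in>{1..16}. i \<noteq> j \<longrightarrow> \<not> C i \<cong> C j) \<and>
      card (char_orbit (C 1)) = 1 \<and>
      card (char_orbit (C 2)) = 7 \<and>
      card (char_orbit (C 4)) = 21 \<and>
      card (char_orbit (C 5)) = 28 \<and>
      card (char_orbit (C 14)) = 28 \<and>
      card (char_orbit (C 15)) = 28 \<and>
      card (char_orbit (C 6)) = 8 \<and>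
      card (char_orbit (C 7)) = 56 \<and>
      card (char_orbit (C 8)) = 56 \<and>
      card (char_orbit (C 13)) = 56 \<and>
      card (char_orbit (C 9)) = 168 \<and>
      card (char_orbit (C 12)) = 168 \<and>
      card (char_orbit (C 16)) = 168 \<and>
      card (char_orbit (C 10)) = 112 \<and>
      card (char_orbit (C 11)) = 112"
  proof (rule allI, rule impI)
    fix C :: "nat \<Rightarrow> 'a monoid"
    assume C4: "\<forall>i\<in>{1..16}. is_C4 i (C i)"
    then have C: "code_loop_of_rank 4 (C i)" "nonassociative (C i)" "char_orbit (C i) = vec10 ` orb (i - 1)"
      if "i \<in> {1..16}" for i
      using that is_C4_iff[OF that] by blast+
    have exhaustive: "\<exists>i\<in>{1..16}. L \<cong> C i" if L: "code_loop_of_rank 4 L" "nonassociative L" for L :: "'b monoid"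
    proof -
      obtain i where i: "i < 16" "char_orbit L = vec10 ` orb i"
        using char_orbit_classify[OF L] by blast
      \<comment> \<open>Loops are numbered from 1, representatives from 0.\<close>
      then have S: "Suc i \<in> {1..16}" by auto
      have "vec10 (reps ! i) \<in> char_orbit L" "vec10 (reps ! i) \<in> char_orbit (C (Suc i))"
        using rep_in_orb i(2) C(3)[OF S] by auto
      then have "L \<cong> C (Suc i)"
        by (rule iso_if_common_char_vector[OF L C(1,2)[OF S]])
      then show ?thesis using S by blast
    qed
    have distinct: "\<not> C i \<cong> C j" if ij: "i \<in> {1..16}" "j \<in> {1..16}" "i \<noteq> j" for i j
    proof
      assume "C i \<cong> C j"
      then obtain h where "h \<in> iso (C i) (C j)" unfolding is_iso_def by blast
      then have "vec10 ` orb (i - 1) = vec10 ` orb (j - 1)"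
        using char_orbit_iso[OF C(1,2)[OF ij(1)] C(1,2)[OF ij(2)]] C(3)[OF ij(1)] C(3)[OF ij(2)] by simp
      then have "orb (i - 1) = orb (j - 1)"
        using inj_vec10 by (simp add: inj_image_eq_iff)
      moreover have "orb (i - 1) \<inter> orb (j - 1) = {}"
        using ij by (intro orb_disjoint) auto
      ultimately show False using rep_in_orb by blast
    qed
    have card: "card (char_orbit (C i)) = orbit_sizes ! (i - 1)" if "i \<in> {1..16}" for i
      using card_char_orbit C4 that by blast
    show "(\<forall>L :: 'b monoid. code_loop_of_rank 4 L \<and> nonassociative L \<longrightarrow>
         (\<exists>i\<in>{1..16}. L \<cong> C i)) \<and>
      (\<forall>i\<in>{1..16}. \<forall>j\<in>{1..16}. i \<noteq> j \<longrightarrow> \<not> C i \<cong> C j) \<and>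
      card (char_orbit (C 1)) = 1 \<and>
      card (char_orbit (C 2)) = 7 \<and>
      card (char_orbit (C 4)) = 21 \<and>
      card (char_orbit (C 5)) = 28 \<and>
      card (char_orbit (C 14)) = 28 \<and>
      card (char_orbit (C 15)) = 28 \<and>
      card (char_orbit (C 6)) = 8 \<and>
      card (char_orbit (C 7)) = 56 \<and>
      card (char_orbit (C 8)) = 56 \<and>
      card (char_orbit (C 13)) = 56 \<and>
      card (char_orbit (C 9)) = 168 \<and>
      card (char_orbit (C 12)) = 168 \<and>
      card (char_orbit (C 16)) = 168 \<and>
      card (char_orbit (C 10)) = 112 \<and>
      card (char_orbit (C 11)) = 112"
      using exhaustive distinct by (simp add: card orbit_sizes_def)
  qed
qed

end
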